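(* Let $A\in\mathbb{R}^{n\times n}$, $B\in\mathbb{R}^{n\times m}$ with $(A,B)$ controllable. Let $G_0\in\mathbb{R}^{n\times n}$, $Y_0\in\mathbb{R}^{m\times n}$ satisfy $$AG_0+BY_0=G_0A+A,\qquad G_0B=\mathbf{0},$$ with $G_0-I_n$ invertible and such that $I_n+\mu G_0$ is anti-Hurwitz for every $\mu\in[-1,1/n]$. Put $K_0=Y_0(G_0-I_n)^{-1}$, $A_0=A+BK_0$, where $A_0$ is nilpotent. Suppose $G_0$ is diagonalizable: $G_0=\Gamma\Lambda_0\Gamma^{-1}$ with $\Gamma\in\mathbb{R}^{n\times n}$ invertible and $\Lambda_0=\mathrm{diag}(\tilde\lambda_1,\dots,\tilde\lambda_n)$ real diagonal. Let $0\le\mu_1\le1/n$ and $-1\le\mu_2<0$, and let $\mathbf{d}_i(s)=e^{sG_{\mathbf{d}_i}}$ with $G_{\mathbf{d}_i}=I_n+\mu_iG_0$, $i=1,2$. Suppose $X\in\mathbb{R}^{n\times n}$, $Y\in\mathbb{R}^{m\times n}$ satisfy $$\begin{cases}XA_0^\top+A_0X+Y^\top B^\top+BY\prec0,\qquad X\succ0,\\ 2(1+\mu_1)X\succeq XG_{\mathbf{d}_1}^\top+G_{\mathbf{d}_1}X\succ0,\\ XG_{\mathbf{d}_2}^\top+G_{\mathbf{d}_2}X\succeq2(1+\mu_2)X,\end{cases}$$ let $K=YX^{-1}$, $P=X^{-1}$, $\|x\|=\sqrt{x^\top Px}$, and let $\|\cdot\|_{\mathbf{d}_i}$, $i=1,2$,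 be the canonical homogeneous norms induced by $\|\cdot\|$ (the dilations $\mathbf{d}_i$ being strictly monotone with respect to $\|\cdot\|$, i.e. $PG_{\mathbf{d}_i}+G_{\mathbf{d}_i}^\top P\succ0$). Let $\mathfrak{q}$ be the logarithmic quantizer with parameter $\delta\in(0,1)$ in the coordinates $\Gamma^{-1}x$, i.e. $$\mathfrak{q}(x)=\Gamma[q(\xi_{x,1}),\dots,q(\xi_{x,n})]^\top,\qquad [\xi_{x,1},\dots,\xi_{x,n}]^\top=\Gamma^{-1}x.$$ Consider the system $\dot x=Ax+Bu$, $x(0)=x_0$, with the feedback $$u=\begin{cases}K_0\mathfrak{q}(x)+\|\mathfrak{q}(x)\|_{\mathbf{d}_1}^{1+\mu_1}K\,\mathbf{d}_1(-\ln\|\mathfrak{q}(x)\|_{\mathbf{d}_1})\,\mathfrak{q}(x)&\text{if }\|\mathfrak{q}(x)\|\ge1,\\ K_0\mathfrak{q}(x)+\|\mathfrak{q}(x)\|_{\mathbf{d}_2}^{1+\mu_2}K\,\mathbf{d}_2(-\ln\|\mathfrak{q}(x)\|_{\mathbf{d}_2})\,\mathfrak{q}(x)&\text{if }\|\mathfrak{q}(x)\|<1,\end{cases}$$ with solutions understood in the sense of Filippov. Then for all sufficiently small $\delta\in(0,1)$ (i.e. there is $\delta_0\in(0,1)$ such that for all $\delta\in(0,\delta_0)$) the closed-loop system is - globally uniformly finite-time stable if $\mu_1=0$; - globally uniformly fixed-time stable if $\mu_1>0$.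
   Context: Notation: $\mathbb{R}_+=[0,\infty)$; $M\succ0$ ($\succeq0$, $\prec0$) means $M$ is symmetric positive definite (positive semidefinite, negative definite); a matrix is anti-Hurwitz if all its eigenvalues have positive real part; $\mathcal{K}$ is the set of continuous strictly increasing functions $\alpha:\mathbb{R}_+\to\mathbb{R}_+$ with $\alpha(0)=0$. Scalar logarithmic quantizer with parameter $\delta\in(0,1)$: fix $\zeta_0>0$ and let $\nu\in(0,1)$ be given by $\delta=(1-\nu)/(1+\nu)$; then $q:\mathbb{R}\to\mathbb{R}$ is defined by $q(\phi)=\nu^i\zeta_0$ if $\frac{1}{1+\delta}\nu^i\zeta_0<\phi\le\frac{1}{1-\delta}\nu^i\zeta_0$, $i=0,\pm1,\pm2,\dots$; $q(0)=0$; $q(\phi)=-q(-\phi)$ for $\phi<0$. Canonical homogeneous norm: for a linear dilation $\mathbf{d}(s)=e^{sG_{\mathbf d}}$ with $P\succ0$ and $PG_{\mathbf d}+G_{\mathbf d}^\top P\succ0$, and $\|x\|=\sqrt{x^\top Px}$, set $\|\mathbf{0}\|_{\mathbf d}=0$ and, for $x\ne\mathbf{0}$, $\|x\|_{\mathbf d}=e^s$ where $s\in\mathbb{R}$ is the unique number with $\|\mathbf{d}(-s)x\|=1$. The nonlinear term of the feedback is taken to be $\mathbf{0}$ when $\mathfrak{q}(x)=\mathbf{0}$. Stability notions (for all solutions $x(t)$, $t\ge0$, with $x(0)=x_0$). The system is globally uniformly - Lyapunov stable if there is $\alpha\in\mathcal{K}$ with $\|x(t)\|\le\alpha(\|x_0\|)$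 for all $x_0\in\mathbb{R}^n$, $t\ge0$; - finite-time stable if it is globally uniformly Lyapunov stable and there is a locally bounded $T:\mathbb{R}^n\to\mathbb{R}_+$ with $\|x(t)\|=0$ for all $t\ge T(x_0)$, $x_0\in\mathbb{R}^n$; - fixed-time stable if it is globally uniformly finite-time stable and $T$ can be taken globally bounded: there is $T_{\max}\in\mathbb{R}_+$ with $T(x_0)\le T_{\max}$ for all $x_0\in\mathbb{R}^n$. *)

theory Defs
  imports "HOL-Analysis.Analysis"
begin

section \<open>Matrices\<close>

text \<open>The type \<^typ>\<open>real^'n^'n\<close> carries the componentwise multiplication of \<^const>\<open>times\<close>, so
  neither the overloaded power nor \<^const>\<open>exp\<close> is the matrix one.\<close>

primrec mat_pow :: "real^'n^'n \<Rightarrow> nat \<Rightarrow> real^'n^'n" where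
  "mat_pow M 0 = mat 1"
| "mat_pow M (Suc k) = M ** mat_pow M k"

definition mat_exp :: "real^'n^'n \<Rightarrow> real^'n^'n" where
  "mat_exp M = (\<Sum>k. (1 / fact k) *\<^sub>R mat_pow M k)"

definition nilpotent :: "real^'n^'n \<Rightarrow> bool" where
  "nilpotent M \<longleftrightarrow> (\<exists>k. mat_pow M k = 0)"

definition diag_mat :: "real^'n \<Rightarrow> real^'n^'n" where
  "diag_mat l = (\<chi> i j. if i = j then l $ i else 0)"

definition pos_def :: "real^'n^'n \<Rightarrow> bool" where
  "pos_def M \<longleftrightarrow> transpose M = M \<and> (\<forall>x. x \<noteq> 0 \<longrightarrow> x \<bullet> (M *v x) > 0)"

definition pos_semidef :: "real^'n^'n \<Rightarrow> bool" where
  "pos_semidef M \<longleftrightarrow> transpose M = M \<and> (\<forall>x. x \<bullet> (M *v x) \<ge> 0)"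

definition neg_def :: "real^'n^'n \<Rightarrow> bool" where
  "neg_def M \<longleftrightarrow> transpose M = M \<and> (\<forall>x. x \<noteq> 0 \<longrightarrow> x \<bullet> (M *v x) < 0)"

definition cmat_of :: "real^'n^'n \<Rightarrow> complex^'n^'n" where
  "cmat_of M = (\<chi> i j. complex_of_real (M $ i $ j))"

definition anti_hurwitz :: "real^'n^'n \<Rightarrow> bool" where
  "anti_hurwitz M \<longleftrightarrow>
     (\<forall>(c::complex) v. v \<noteq> 0 \<and> cmat_of M *v v = c *s v \<longrightarrow> Re c > 0)"


section \<open>Absolutely continuous curves, controllability, Filippov solutions\<close>

definition abs_continuous_on_ivl :: "real \<Rightarrow> real \<Rightarrow> (real \<Rightarrow> 'a::real_normed_vector) \<Rightarrow> bool" where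
  "abs_continuous_on_ivl a b x \<longleftrightarrow>
     (\<forall>\<epsilon>>0. \<exists>\<eta>>0. \<forall>(k::nat) l r.
        (\<forall>i<k. a \<le> l i \<and> l i \<le> r i \<and> r i \<le> b) \<and>
        disjoint_family_on (\<lambda>i. {l i<..<r i}) {..<k} \<and>
        (\<Sum>i<k. r i - l i) < \<eta>
        \<longrightarrow> (\<Sum>i<k. norm (x (r i) - x (l i))) < \<epsilon>)"

text \<open>State-to-state controllability of \<open>x' = A x + B u\<close> with integrable inputs.\<close>

definition controllable :: "real^'n^'n \<Rightarrow> real^'m^'n \<Rightarrow> bool" where
  "controllable A B \<longleftrightarrow>
     (\<forall>x0 x1. \<exists>T>0. \<exists>(u :: real \<Rightarrow> real^'m) (x :: real \<Rightarrow> real^'n).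
        u absolutely_integrable_on {0..T} \<and>
        abs_continuous_on_ivl 0 T x \<and>
        (AE t in lebesgue. 0 < t \<and> t < T \<longrightarrow>
           (x has_vector_derivative (A *v x t + B *v u t)) (at t)) \<and>
        x 0 = x0 \<and> x T = x1)"

definition filippov_map :: "(real^'n \<Rightarrow> real^'n) \<Rightarrow> real^'n \<Rightarrow> (real^'n) set" where
  "filippov_map f x =
     (\<Inter>\<epsilon>\<in>{0<..}. \<Inter>N\<in>{N. negligible N}. closure (convex hull (f ` (ball x \<epsilon> - N))))"

text \<open>Only the values of the curve on \<open>[0,\<infinity>)\<close> matter.\<close>

definition filippov_solution ::
  "(real^'n \<Rightarrow> real^'n) \<Rightarrow> real^'n \<Rightarrow> (real \<Rightarrow> real^'n) \<Rightarrow> bool" where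
  "filippov_solution f x0 x \<longleftrightarrow>
     x 0 = x0 \<and>
     (\<forall>T>0. abs_continuous_on_ivl 0 T x) \<and>
     (AE t in lebesgue. t > 0 \<longrightarrow>
        (\<exists>v \<in> filippov_map f (x t). (x has_vector_derivative v) (at t)))"


section \<open>Stability notions\<close>

text \<open>The first argument \<open>N\<close> is the norm on the state space, the second one the right-hand side of
  the differential equation.\<close>

definition class_K :: "(real \<Rightarrow> real) \<Rightarrow> bool" where
  "class_K \<alpha> \<longleftrightarrow>
     continuous_on {0..} \<alpha> \<and> strict_mono_on {0..} \<alpha> \<and> \<alpha> ` {0..} \<subseteq> {0..} \<and> \<alpha> 0 = 0"

definition lyapunov_stable :: "(real^'n \<Rightarrow> real) \<Rightarrow> (real^'n \<Rightarrow> real^'n) \<Rightarrow> bool" where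
  "lyapunov_stable N f \<longleftrightarrow>
     (\<exists>\<alpha>. class_K \<alpha> \<and>
        (\<forall>x0 x. filippov_solution f x0 x \<longrightarrow> (\<forall>t\<ge>0. N (x t) \<le> \<alpha> (N x0))))"

definition locally_bounded :: "(real^'n \<Rightarrow> real) \<Rightarrow> bool" where
  "locally_bounded T \<longleftrightarrow> (\<forall>x. \<exists>U. open U \<and> x \<in> U \<and> bounded (T ` U))"

definition settling_time ::
  "(real^'n \<Rightarrow> real) \<Rightarrow> (real^'n \<Rightarrow> real^'n) \<Rightarrow> (real^'n \<Rightarrow> real) \<Rightarrow> bool" where
  "settling_time N f T \<longleftrightarrow>
     (\<forall>x0. T x0 \<ge> 0) \<and> locally_bounded T \<and>
     (\<forall>x0 x. filippov_solution f x0 x \<longrightarrow> (\<forall>t\<ge>T x0. N (x t) = 0))"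

definition finite_time_stable :: "(real^'n \<Rightarrow> real) \<Rightarrow> (real^'n \<Rightarrow> real^'n) \<Rightarrow> bool" where
  "finite_time_stable N f \<longleftrightarrow> lyapunov_stable N f \<and> (\<exists>T. settling_time N f T)"

definition fixed_time_stable :: "(real^'n \<Rightarrow> real) \<Rightarrow> (real^'n \<Rightarrow> real^'n) \<Rightarrow> bool" where
  "fixed_time_stable N f \<longleftrightarrow>
     finite_time_stable N f \<and>
     (\<exists>T. settling_time N f T \<and> (\<exists>Tmax\<ge>0. \<forall>x0. T x0 \<le> Tmax))"


section \<open>Homogeneous norms and the feedback law\<close>

definition wnorm :: "real^'n^'n \<Rightarrow> real^'n \<Rightarrow> real" where
  "wnorm P x = sqrt (x \<bullet> (P *v x))"

definition dilation :: "real^'n^'n \<Rightarrow> real \<Rightarrow> real^'n^'n" where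
  "dilation G s = mat_exp (s *\<^sub>R G)"

text \<open>The description below is proper when \<open>P\<close> and \<open>P G + G\<^sup>T P\<close> are positive definite.\<close>

definition hom_norm :: "real^'n^'n \<Rightarrow> real^'n^'n \<Rightarrow> real^'n \<Rightarrow> real" where
  "hom_norm P G x =
     (if x = 0 then 0 else exp (THE s. wnorm P (dilation G (- s) *v x) = 1))"

definition hom_term ::
  "real^'n^'m \<Rightarrow> real^'n^'n \<Rightarrow> real^'n^'n \<Rightarrow> real \<Rightarrow> real^'n \<Rightarrow> real^'m" where
  "hom_term K P G \<mu> z =
     (if z = 0 then 0
      else (hom_norm P G z powr (1 + \<mu>)) *\<^sub>R
             (K *v (dilation G (- ln (hom_norm P G z)) *v z)))"

text \<open>The control as a function of the measured (quantized) state \<open>z\<close>.\<close>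

definition switched_feedback ::
  "real^'n^'m \<Rightarrow> real^'n^'m \<Rightarrow> real^'n^'n \<Rightarrow> real^'n^'n \<Rightarrow> real \<Rightarrow> real^'n^'n \<Rightarrow> real
     \<Rightarrow> real^'n \<Rightarrow> real^'m" where
  "switched_feedback K0 K P G1 \<mu>1 G2 \<mu>2 z =
     (if wnorm P z \<ge> 1 then K0 *v z + hom_term K P G1 \<mu>1 z
      else K0 *v z + hom_term K P G2 \<mu>2 z)"


section \<open>Logarithmic quantizer\<close>

definition quant_ratio :: "real \<Rightarrow> real" where
  "quant_ratio \<delta> = (THE \<nu>. 0 < \<nu> \<and> \<nu> < 1 \<and> \<delta> = (1 - \<nu>) / (1 + \<nu>))"

definition quant_cell :: "real \<Rightarrow> real \<Rightarrow> real \<Rightarrow> int \<Rightarrow> bool" where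
  "quant_cell \<delta> \<zeta>0 \<phi> i \<longleftrightarrow>
     1 / (1 + \<delta>) * (quant_ratio \<delta> powi i) * \<zeta>0 < \<phi> \<and>
     \<phi> \<le> 1 / (1 - \<delta>) * (quant_ratio \<delta> powi i) * \<zeta>0"

definition log_quant :: "real \<Rightarrow> real \<Rightarrow> real \<Rightarrow> real" where
  "log_quant \<delta> \<zeta>0 \<phi> =
     (if \<phi> > 0 then (quant_ratio \<delta> powi (THE i. quant_cell \<delta> \<zeta>0 \<phi> i)) * \<zeta>0
      else if \<phi> < 0 then - ((quant_ratio \<delta> powi (THE i. quant_cell \<delta> \<zeta>0 (- \<phi>) i)) * \<zeta>0)
      else 0)"

definition vec_quant :: "real^'n^'n \<Rightarrow> real \<Rightarrow> real \<Rightarrow> real^'n \<Rightarrow> real^'n" where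
  "vec_quant \<Gamma> \<delta> \<zeta>0 x = \<Gamma> *v (\<chi> i. log_quant \<delta> \<zeta>0 ((matrix_inv \<Gamma> *v x) $ i))"

lemma quant_ratio_eq:
  assumes "0 < \<delta>" "\<delta> < 1"
  shows "quant_ratio \<delta> = (1 - \<delta>) / (1 + \<delta>)"
  unfolding quant_ratio_def
proof (rule the_equality)
  show "0 < (1 - \<delta>) / (1 + \<delta>) \<and> (1 - \<delta>) / (1 + \<delta>) < 1
      \<and> \<delta> = (1 - (1 - \<delta>) / (1 + \<delta>)) / (1 + (1 - \<delta>) / (1 + \<delta>))"
    using assms by (auto simp: field_simps)
next
  fix \<nu> :: real assume "0 < \<nu> \<and> \<nu> < 1 \<and> \<delta> = (1 - \<nu>) / (1 + \<nu>)"
  then have "\<delta> * (1 + \<nu>) = 1 - \<nu>" by (simp add: field_simps)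
  then have "\<nu> * (1 + \<delta>) = 1 - \<delta>" by (simp add: algebra_simps)
  then show "\<nu> = (1 - \<delta>) / (1 + \<delta>)" using assms by (simp add: field_simps)
qed

lemma ex1_quant_cell:
  assumes d: "0 < \<delta>" "\<delta> < 1" and z: "0 < \<zeta>0" and p: "0 < \<phi>"
  shows "\<exists>!i. quant_cell \<delta> \<zeta>0 \<phi> i"
proof -
  define \<nu> where "\<nu> = (1 - \<delta>) / (1 + \<delta>)"
  define c where "c = \<zeta>0 / (1 + \<delta>)"
  define L where "L = log (1 / \<nu>) (\<phi> / c)"
  have nu: "0 < \<nu>" "\<nu> < 1" using d by (auto simp: \<nu>_def field_simps)
  have c: "0 < c" using d z by (simp add: c_def)
  have b: "1 / \<nu> > 1" using nu by simp
  have pc: "\<phi> = (1 / \<nu>) powr L * c"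
    using b c p nu by (simp add: L_def)
  have pw: "\<nu> powi i = (1 / \<nu>) powr (- of_int i)" for i :: int
    using nu by (simp add: powr_real_of_int' powr_minus powr_divide)
  have up: "1 / (1 - \<delta>) * \<nu> powi i * \<zeta>0 = (1 / \<nu>) powr (1 - of_int i) * c" for i :: int
  proof -
    have "(1 / \<nu>) powr (1 - of_int i) = (1 / \<nu>) * \<nu> powi i"
      using nu unfolding pw diff_conv_add_uminus powr_add by simp
    then show ?thesis using d by (simp add: \<nu>_def c_def)
  qed
  have lo: "1 / (1 + \<delta>) * \<nu> powi i * \<zeta>0 = (1 / \<nu>) powr (- of_int i) * c" for i :: int
    unfolding pw by (simp add: c_def)
  have "quant_cell \<delta> \<zeta>0 \<phi> i \<longleftrightarrow> - of_int i < L \<and> L \<le> 1 - of_int i" for i :: int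
    unfolding quant_cell_def quant_ratio_eq[OF d] \<nu>_def[symmetric] lo up
    using b c unfolding pc by simp
  then have eq: "quant_cell \<delta> \<zeta>0 \<phi> i \<longleftrightarrow> \<lceil>L\<rceil> = 1 - i" for i :: int
    by (simp add: ceiling_eq_iff)
  have "quant_cell \<delta> \<zeta>0 \<phi> i \<longleftrightarrow> i = 1 - \<lceil>L\<rceil>" for i
    unfolding eq by linarith
  then show ?thesis by simp
qed

end

theory Submission
  imports Defs
begin

text \<open>
  The identities for \<open>G\<^sub>0\<close> say that \<open>A\<^sub>0 d(s) = exp (\<mu> s) d(s) A\<^sub>0\<close> and \<open>d(s) B = exp s B\<close>, and the
  quantizer multiplies the coordinates \<open>\<Gamma>\<^sup>-\<^sup>1 x\<close> by factors in \<open>[1 - \<delta>, 1 + \<delta>]\<close>, hence commutes with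
  both dilations. In the coordinates \<open>z = d(-\<sigma>) x\<close> with \<open>z\<close> close to the unit sphere, the closed-loop field is
  therefore \<open>exp (\<mu> \<sigma>)\<close> times a small perturbation of \<open>(A\<^sub>0 + B K) z\<close>, which points inwards by
  the first matrix inequality.

  Instead of differentiating the homogeneous norm, a slowly decreasing \<open>\<sigma>(t)\<close> with
  \<open>- \<sigma>' \<le> c exp (\<mu> \<sigma>)\<close> is used as a barrier: \<open>\<parallel>d(-\<sigma>(t)) x(t)\<parallel> \<le> 1\<close> is preserved along Filippov
  solutions. Constant \<open>\<sigma>\<close> gives Lyapunov stability. The extremal \<open>\<sigma>\<close> brings the state into the
  unit ball with the first dilation, in a time bounded uniformly when \<open>\<mu>\<^sub>1 > 0\<close>, and then to the
  origin in a fixed time with the second one, since \<open>\<mu>\<^sub>2 < 0\<close>.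
\<close>

section \<open>Absolutely continuous curves\<close>

text \<open>The obstacle is uniformity: the perturbation must stay small for all levels
  \<open>\<sigma>\<close> of a half-line, hence arbitrarily far from the origin or close to it.
  Homogeneous terms lose \<open>\<sigma>\<close> under the rescaling, but \<open>K0\<close> also
  acts on the quantization error, and the switch looks at the quantized state. The former is
  controlled when \<open>\<mu> * \<sigma> \<ge> 0\<close> and the eigenvalues of \<open>G0\<close>
  are at most 1, which is what the last matrix inequality contributes; the latter when each dilation
  keeps to its own side of the unit sphere. A barrier is convenient because
  \<open>V (D (- \<sigma> t) (x t))\<close> is built by bilinear maps from explicit absolutely
  continuous curves, whereas the homogeneous norm is implicit. Its preservation is a first-exit
  argument, so inward pointing is needed only on a thin shell outside the sphere, and there a
  compactness argument provides it.\<close>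

lemma abs_continuous_on_ivl_finite:
  fixes f :: "real \<Rightarrow> 'a::real_normed_vector"
  assumes "abs_continuous_on_ivl a b f" "0 < \<epsilon>"
  shows "\<exists>\<eta>>0. \<forall>(S :: 'i set) l r. finite S \<and> (\<forall>i\<in>S. a \<le> l i \<and> l i \<le> r i \<and> r i \<le> b) \<and>
          disjoint_family_on (\<lambda>i. {l i<..<r i}) S \<and> (\<Sum>i\<in>S. r i - l i) < \<eta>
          \<longrightarrow> (\<Sum>i\<in>S. norm (f (r i) - f (l i))) < \<epsilon>"
proof -
  obtain \<eta> where \<eta>: "0 < \<eta>" and *: "\<And>(k::nat) l r. \<lbrakk>\<forall>i<k. a \<le> l i \<and> l i \<le> r i \<and> r i \<le> b;
        disjoint_family_on (\<lambda>i. {l i<..<r i}) {..<k}; (\<Sum>i<k. r i - l i) < \<eta>\<rbrakk>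
        \<Longrightarrow> (\<Sum>i<k. norm (f (r i) - f (l i))) < \<epsilon>"
    using assms unfolding abs_continuous_on_ivl_def by meson
  show ?thesis
  proof (intro exI[of _ \<eta>] conjI allI impI, rule \<eta>, elim conjE)
    fix S :: "'i set" and l r
    assume S: "finite S" "\<forall>i\<in>S. a \<le> l i \<and> l i \<le> r i \<and> r i \<le> b"
      "disjoint_family_on (\<lambda>i. {l i<..<r i}) S" "(\<Sum>i\<in>S. r i - l i) < \<eta>"
    obtain h where h: "bij_betw h {..<card S} S"
      using ex_bij_betw_nat_finite[OF S(1)] by (metis atLeast0LessThan)
    have sum: "(\<Sum>i<card S. g (h i)) = (\<Sum>i\<in>S. g i)" for g :: "'i \<Rightarrow> real"
      using sum.reindex_bij_betw[OF h] .
    have "(\<Sum>i<card S. norm (f (r (h i)) - f (l (h i)))) < \<epsilon>"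
    proof (rule *)
      show "\<forall>i<card S. a \<le> l (h i) \<and> l (h i) \<le> r (h i) \<and> r (h i) \<le> b"
        using h S(2) by (auto simp: bij_betw_def)
      show "disjoint_family_on (\<lambda>i. {l (h i)<..<r (h i)}) {..<card S}"
        using h S(3) unfolding disjoint_family_on_def bij_betw_def inj_on_def by blast
      show "(\<Sum>i<card S. r (h i) - l (h i)) < \<eta>"
        using sum[of "\<lambda>i. r i - l i"] S(4) by simp
    qed
    then show "(\<Sum>i\<in>S. norm (f (r i) - f (l i))) < \<epsilon>"
      using sum[of "\<lambda>i. norm (f (r i) - f (l i))"] by simp
  qed
qed

lemma abs_continuous_on_ivl_subset:
  assumes "abs_continuous_on_ivl a b f" "a \<le> c" "d \<le> b"
  shows "abs_continuous_on_ivl c d f"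
  unfolding abs_continuous_on_ivl_def
proof (intro allI impI)
  fix \<epsilon> :: real assume "0 < \<epsilon>"
  then obtain \<eta> where \<eta>: "0 < \<eta>" and *: "\<And>(k::nat) l r. \<lbrakk>\<forall>i<k. a \<le> l i \<and> l i \<le> r i \<and> r i \<le> b;
        disjoint_family_on (\<lambda>i. {l i<..<r i}) {..<k}; (\<Sum>i<k. r i - l i) < \<eta>\<rbrakk>
        \<Longrightarrow> (\<Sum>i<k. norm (f (r i) - f (l i))) < \<epsilon>"
    using assms unfolding abs_continuous_on_ivl_def by meson
  show "\<exists>\<eta>>0. \<forall>(k::nat) l r. (\<forall>i<k. c \<le> l i \<and> l i \<le> r i \<and> r i \<le> d) \<and>
        disjoint_family_on (\<lambda>i. {l i<..<r i}) {..<k} \<and> (\<Sum>i<k. r i - l i) < \<eta>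
        \<longrightarrow> (\<Sum>i<k. norm (f (r i) - f (l i))) < \<epsilon>"
  proof (intro exI[of _ \<eta>] conjI allI impI)
    fix k :: nat and l r
    assume A: "(\<forall>i<k. c \<le> l i \<and> l i \<le> r i \<and> r i \<le> d) \<and>
        disjoint_family_on (\<lambda>i. {l i<..<r i}) {..<k} \<and> (\<Sum>i<k. r i - l i) < \<eta>"
    show "(\<Sum>i<k. norm (f (r i) - f (l i))) < \<epsilon>"
      using A assms(2,3) by (intro *) force+
  qed (rule \<eta>)
qed

lemma abs_continuous_on_ivl_lipschitz_comp:
  fixes f :: "real \<Rightarrow> 'a::real_normed_vector" and g :: "real \<Rightarrow> 'b::real_normed_vector"
    and h :: "real \<Rightarrow> 'c::real_normed_vector"
  assumes f: "abs_continuous_on_ivl a b f" and g: "abs_continuous_on_ivl a b g"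
    and L: "\<And>s t. \<lbrakk>a \<le> s; s \<le> t; t \<le> b\<rbrakk>
      \<Longrightarrow> norm (h t - h s) \<le> L * (norm (f t - f s) + norm (g t - g s))"
  shows "abs_continuous_on_ivl a b h"
  unfolding abs_continuous_on_ivl_def
proof (intro allI impI)
  fix \<epsilon> :: real assume \<epsilon>: "0 < \<epsilon>"
  \<comment> \<open>\<open>L\<close> may be negative; a positive majorant is needed to split
    \<open>\<epsilon>\<close> into two shares.\<close>
  define M where "M = \<bar>L\<bar> + 1"
  have M: "0 < M" "L \<le> M" by (auto simp: M_def)
  define e where "e = \<epsilon> / (2 * M)"
  have e: "0 < e" using \<epsilon> M by (simp add: e_def)
  obtain \<eta>1 where \<eta>1: "0 < \<eta>1" and *: "\<And>(k::nat) l r. \<lbrakk>\<forall>i<k. a \<le> l i \<and> l i \<le> r i \<and> r i \<le> b;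
        disjoint_family_on (\<lambda>i. {l i<..<r i}) {..<k}; (\<Sum>i<k. r i - l i) < \<eta>1\<rbrakk>
        \<Longrightarrow> (\<Sum>i<k. norm (f (r i) - f (l i))) < e"
    using f e unfolding abs_continuous_on_ivl_def by meson
  obtain \<eta>2 where \<eta>2: "0 < \<eta>2" and **: "\<And>(k::nat) l r. \<lbrakk>\<forall>i<k. a \<le> l i \<and> l i \<le> r i \<and> r i \<le> b;
        disjoint_family_on (\<lambda>i. {l i<..<r i}) {..<k}; (\<Sum>i<k. r i - l i) < \<eta>2\<rbrakk>
        \<Longrightarrow> (\<Sum>i<k. norm (g (r i) - g (l i))) < e"
    using g e unfolding abs_continuous_on_ivl_def by meson
  show "\<exists>\<eta>>0. \<forall>(k::nat) l r. (\<forall>i<k. a \<le> l i \<and> l i \<le> r i \<and> r i \<le> b) \<and>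
        disjoint_family_on (\<lambda>i. {l i<..<r i}) {..<k} \<and> (\<Sum>i<k. r i - l i) < \<eta>
        \<longrightarrow> (\<Sum>i<k. norm (h (r i) - h (l i))) < \<epsilon>"
  proof (intro exI[of _ "min \<eta>1 \<eta>2"] conjI allI impI)
    show "0 < min \<eta>1 \<eta>2" using \<eta>1 \<eta>2 by simp
    fix k :: nat and l r
    assume A: "(\<forall>i<k. a \<le> l i \<and> l i \<le> r i \<and> r i \<le> b) \<and>
        disjoint_family_on (\<lambda>i. {l i<..<r i}) {..<k} \<and> (\<Sum>i<k. r i - l i) < min \<eta>1 \<eta>2"
    have "(\<Sum>i<k. norm (h (r i) - h (l i)))
        \<le> (\<Sum>i<k. M * (norm (f (r i) - f (l i)) + norm (g (r i) - g (l i))))"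
    proof (rule sum_mono)
      fix i assume "i \<in> {..<k}"
      then have "norm (h (r i) - h (l i)) \<le> L * (norm (f (r i) - f (l i)) + norm (g (r i) - g (l i)))"
        using A by (intro L) auto
      also have "\<dots> \<le> M * (norm (f (r i) - f (l i)) + norm (g (r i) - g (l i)))"
        using M by (intro mult_right_mono) auto
      finally show "norm (h (r i) - h (l i)) \<le> \<dots>" .
    qed
    also have "\<dots> = M * ((\<Sum>i<k. norm (f (r i) - f (l i))) + (\<Sum>i<k. norm (g (r i) - g (l i))))"
      by (simp add: sum_distrib_left sum.distrib ring_distribs)
    also have "\<dots> < M * (e + e)"
      using *[of k l r] **[of k l r] A M by (intro mult_strict_left_mono add_strict_mono) auto
    also have "\<dots> = \<epsilon>" using M by (simp add: e_def)
    finally show "(\<Sum>i<k. norm (h (r i) - h (l i))) < \<epsilon>" .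
  qed
qed

lemma abs_continuous_on_ivl_id: "abs_continuous_on_ivl a b (\<lambda>t::real. t)"
  unfolding abs_continuous_on_ivl_def
proof (intro allI impI)
  fix \<epsilon> :: real assume "0 < \<epsilon>"
  have "(\<Sum>i<k. norm (r i - l i)) < \<epsilon>"
    if "\<forall>i<k. a \<le> l i \<and> l i \<le> r i \<and> r i \<le> b" "(\<Sum>i<k. r i - l i) < \<epsilon>"
    for k :: nat and l r :: "nat \<Rightarrow> real"
  proof -
    have "(\<Sum>i<k. norm (r i - l i)) = (\<Sum>i<k. r i - l i)"
      using that(1) by (intro sum.cong) auto
    then show ?thesis using that by simp
  qed
  then show "\<exists>\<eta>>0. \<forall>(k::nat) l r. (\<forall>i<k. a \<le> l i \<and> l i \<le> r i \<and> r i \<le> b) \<and>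
        disjoint_family_on (\<lambda>i. {l i<..<r i}) {..<k} \<and> (\<Sum>i<k. r i - l i) < \<eta>
        \<longrightarrow> (\<Sum>i<k. norm (r i - l i)) < \<epsilon>"
    using \<open>0 < \<epsilon>\<close> by blast
qed

lemma abs_continuous_on_ivl_lipschitz:
  fixes h :: "real \<Rightarrow> 'a::real_normed_vector"
  assumes "\<And>s t. \<lbrakk>a \<le> s; s \<le> t; t \<le> b\<rbrakk> \<Longrightarrow> norm (h t - h s) \<le> L * (t - s)"
  shows "abs_continuous_on_ivl a b h"
proof (rule abs_continuous_on_ivl_lipschitz_comp[OF abs_continuous_on_ivl_id abs_continuous_on_ivl_id, of _ _ _ "L/2"])
  fix s t assume "a \<le> s" "s \<le> t" "t \<le> b"
  then show "norm (h t - h s) \<le> L / 2 * (norm (t - s) + norm (t - s))"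
    using assms[of s t] by (simp add: field_simps)
qed

lemma abs_continuous_on_ivl_imp_continuous:
  fixes f :: "real \<Rightarrow> 'a::real_normed_vector"
  assumes "abs_continuous_on_ivl a b f"
  shows "continuous_on {a..b} f"
proof (rule continuous_onI)
  fix x \<epsilon> :: real assume x: "x \<in> {a..b}" and "0 < \<epsilon>"
  obtain \<eta> where \<eta>: "0 < \<eta>"
    and *: "\<forall>(S :: unit set) l r. finite S \<and> (\<forall>i\<in>S. a \<le> l i \<and> l i \<le> r i \<and> r i \<le> b) \<and>
          disjoint_family_on (\<lambda>i. {l i<..<r i}) S \<and> (\<Sum>i\<in>S. r i - l i) < \<eta>
          \<longrightarrow> (\<Sum>i\<in>S. norm (f (r i) - f (l i))) < \<epsilon>"
    using abs_continuous_on_ivl_finite[OF assms \<open>0 < \<epsilon>\<close>] by blast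
  show "\<exists>d>0. \<forall>x'\<in>{a..b}. dist x' x < d \<longrightarrow> dist (f x') (f x) \<le> \<epsilon>"
  proof (intro exI conjI ballI impI)
    fix y assume y: "y \<in> {a..b}" "dist y x < \<eta>"
    have "norm (f (max x y) - f (min x y)) < \<epsilon>"
      using *[rule_format, of "{()}" "\<lambda>_. min x y" "\<lambda>_. max x y"] x y
      by (auto simp: disjoint_family_on_def dist_real_def max_def min_def split: if_splits)
    then show "dist (f y) (f x) \<le> \<epsilon>"
      by (cases "x \<le> y") (auto simp: dist_norm norm_minus_commute max_def min_def)
  qed (rule \<eta>)
qed

text \<open>Both curves are bounded on the compact interval, so the product changes by at most a
  constant times the two increments. It serves \<open>D (- \<sigma> t) (x t)\<close> and the
  quadratic form \<open>V\<close>.\<close>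

lemma (in bounded_bilinear) abs_continuous_on_ivl:
  fixes f :: "real \<Rightarrow> 'a" and g :: "real \<Rightarrow> 'b"
  assumes f: "abs_continuous_on_ivl a b f" and g: "abs_continuous_on_ivl a b g"
  shows "abs_continuous_on_ivl a b (\<lambda>t. prod (f t) (g t))"
proof -
  have "bounded (f ` {a..b})" "bounded (g ` {a..b})"
    using f g by (auto intro!: compact_imp_bounded compact_continuous_image
        abs_continuous_on_ivl_imp_continuous)
  then obtain F G where F: "\<And>t. t \<in> {a..b} \<Longrightarrow> norm (f t) \<le> F"
    and G: "\<And>t. t \<in> {a..b} \<Longrightarrow> norm (g t) \<le> G"
    unfolding bounded_iff by (metis imageI)
  obtain C where C: "\<And>x y. norm (prod x y) \<le> norm x * norm y * C" and C0: "C > 0"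
    using pos_bounded by blast
  show ?thesis
  proof (rule abs_continuous_on_ivl_lipschitz_comp[OF f g, of _ "C * (\<bar>F\<bar> + \<bar>G\<bar>)"])
    fix s t assume st: "a \<le> s" "s \<le> t" "t \<le> b"
    have "prod (f t) (g t) - prod (f s) (g s) = prod (f t) (g t - g s) + prod (f t - f s) (g s)"
      by (simp add: diff_left diff_right)
    then have "norm (prod (f t) (g t) - prod (f s) (g s))
        \<le> norm (f t) * norm (g t - g s) * C + norm (f t - f s) * norm (g s) * C"
      using norm_triangle_le[of "prod (f t) (g t - g s)"] C add_mono by metis
    also have "\<dots> \<le> (\<bar>F\<bar> + \<bar>G\<bar>) * norm (g t - g s) * C + norm (f t - f s) * (\<bar>F\<bar> + \<bar>G\<bar>) * C"
      using F[of t] G[of s] st C0 by (intro add_mono mult_right_mono mult_left_mono) auto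
    finally show "norm (prod (f t) (g t) - prod (f s) (g s))
        \<le> C * (\<bar>F\<bar> + \<bar>G\<bar>) * (norm (f t - f s) + norm (g t - g s))"
      by (simp add: algebra_simps)
  qed
qed

text \<open>Cousin's lemma: intervals tagged outside the exceptional set are controlled by the derivative,
  and the gauge that integrates the indicator of the exceptional set to \<open>0\<close> makes the remaining ones
  short enough for absolute continuity.\<close>

lemma abs_continuous_nonincreasing:
  fixes f :: "real \<Rightarrow> real"
  assumes ac: "abs_continuous_on_ivl a b f" and ab: "a \<le> b"
    and neg: "negligible E"
    and der: "\<And>t. \<lbrakk>a < t; t < b; t \<notin> E\<rbrakk> \<Longrightarrow> \<exists>D\<le>0. (f has_real_derivative D) (at t)"
  shows "f b \<le> f a"
proof (rule field_le_epsilon)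
  fix e :: real assume e: "0 < e"
  \<comment> \<open>The \<open>+ 1\<close> keeps the denominator positive when \<open>a = b\<close>.
    Well-tagged intervals then cost at most \<open>e / 2\<close>, the others less than
    \<open>e / 2\<close>.\<close>
  define \<epsilon> where "\<epsilon> = e / (2 * (b - a + 1))"
  have \<epsilon>: "0 < \<epsilon>" using e ab by (simp add: \<epsilon>_def)
  \<comment> \<open>\<open>der\<close> speaks of interior times only, so the end points join the
    exceptional set.\<close>
  define N where "N = E \<union> {a, b}"
  have N: "negligible N" unfolding N_def using neg by (simp add: negligible_Un_eq)
  \<comment> \<open>The tagged pairs themselves will index the badly tagged intervals; this is why
    absolute continuity was extended to arbitrary finite index sets.\<close>
  obtain \<eta> where \<eta>: "0 < \<eta>"
    and ac': "\<forall>(S :: (real \<times> real set) set) l r. finite S \<and> (\<forall>i\<in>S. a \<le> l i \<and> l i \<le> r i \<and> r i \<le> b) \<and>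
          disjoint_family_on (\<lambda>i. {l i<..<r i}) S \<and> (\<Sum>i\<in>S. r i - l i) < \<eta>
          \<longrightarrow> (\<Sum>i\<in>S. norm (f (r i) - f (l i))) < e / 2"
    using abs_continuous_on_ivl_finite[OF ac half_gt_zero[OF e]] by blast
  have "(indicator N has_integral (0::real)) {a..b}"
    using N unfolding negligible_def by (metis box_real(2))
  then obtain \<gamma>1 where \<gamma>1: "gauge \<gamma>1"
    and small: "\<And>\<D>. \<lbrakk>\<D> tagged_division_of {a..b}; \<gamma>1 fine \<D>\<rbrakk>
       \<Longrightarrow> norm ((\<Sum>(x,k)\<in>\<D>. measure lborel k *\<^sub>R (indicator N x :: real)) - 0) < \<eta>"
    using \<eta> unfolding has_integral_real by meson
  \<comment> \<open>That \<open>t\<close> lies between \<open>u\<close> and \<open>v\<close>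
    matters: both one-sided increments are then \<open>D\<close> times a nonnegative length up to an
    error, and \<open>D \<le> 0\<close> bounds their sum.\<close>
  have "\<exists>d>0. t \<notin> N \<longrightarrow> t \<in> {a..b} \<longrightarrow> (\<forall>u v. u \<le> t \<and> t \<le> v \<and> t - u < d \<and> v - t < d \<longrightarrow> f v - f u \<le> \<epsilon> * (v - u))" for t
  proof (cases "t \<notin> N \<and> t \<in> {a..b}")
    case True
    then have "a < t" "t < b" "t \<notin> E" unfolding N_def by auto
    then obtain D where D: "D \<le> 0" "(f has_real_derivative D) (at t)" using der by blast
    then obtain d where d: "0 < d" and *: "\<And>y. norm (y - t) < d \<Longrightarrow> norm (f y - f t - D * (y - t)) \<le> \<epsilon> * norm (y - t)"
      using \<epsilon> unfolding has_field_derivative_def has_derivative_at_alt by metis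
    have "f v - f u \<le> \<epsilon> * (v - u)" if "u \<le> t \<and> t \<le> v \<and> t - u < d \<and> v - t < d" for u v
    proof -
      have "f v - f t - D * (v - t) \<le> \<epsilon> * (v - t)" "f t - f u - D * (t - u) \<le> \<epsilon> * (t - u)"
        using *[of v] *[of u] that by (auto simp: abs_le_iff algebra_simps)
      moreover have "D * (v - t) \<le> 0" "D * (t - u) \<le> 0"
        using D that by (auto intro: mult_nonpos_nonneg)
      ultimately show ?thesis by (simp add: algebra_simps)
    qed
    then show ?thesis using d by blast
  qed (use zero_less_one in blast)
  then obtain d where d: "\<And>t. 0 < d t"
    and dd: "\<And>t u v. \<lbrakk>t \<notin> N; t \<in> {a..b}; u \<le> t; t \<le> v; t - u < d t; v - t < d t\<rbrakk> \<Longrightarrow> f v - f u \<le> \<epsilon> * (v - u)"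
    by metis
  have "gauge (\<lambda>x. \<gamma>1 x \<inter> ball x (d x))"
    using \<gamma>1 d by (intro gauge_Int gauge_ball_dependent) auto
  then obtain p where p: "p tagged_division_of {a..b}" and fine: "(\<lambda>x. \<gamma>1 x \<inter> ball x (d x)) fine p"
    using fine_division_exists_real by blast
  have fin: "finite p" using p by auto
  have interval: "\<exists>u v. k = {u..v} \<and> u \<le> x \<and> x \<le> v \<and> a \<le> u \<and> v \<le> b" if xk: "(x,k) \<in> p" for x k
  proof -
    obtain u v where "k = cbox u v" "x \<in> k" "k \<subseteq> {a..b}"
      using tagged_division_ofD(2-4)[OF p xk] by metis
    then show ?thesis by (intro exI[of _ u] exI[of _ v]) auto
  qed
  define F where "F = (\<lambda>(x::real, k). f (Sup k) - f (Inf k))"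
  \<comment> \<open>The total length of these intervals is the Riemann sum of the indicator of
    \<open>N\<close>, which \<open>\<gamma>1\<close> keeps below \<open>\<eta>\<close>.\<close>
  define Q where "Q = {i \<in> p. fst i \<in> N}"
  have Qp: "Q \<subseteq> p" "finite Q" using fin by (auto simp: Q_def)
  have good: "sum F (p - Q) \<le> \<epsilon> * (b - a)"
  proof -
    have "sum F (p - Q) \<le> (\<Sum>(x,k)\<in>p - Q. \<epsilon> * measure lborel k)"
    proof (rule sum_mono)
      fix i assume i: "i \<in> p - Q"
      obtain x k where xk: "i = (x, k)" by (cases i)
      obtain u v where uv: "k = {u..v}" "u \<le> x" "x \<le> v" "a \<le> u" "v \<le> b"
        using interval i xk by blast
      have "k \<subseteq> ball x (d x)" using fine i xk unfolding fine_def by blast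
      moreover have "u \<in> k" "v \<in> k" using uv by auto
      ultimately have "u \<in> ball x (d x)" "v \<in> ball x (d x)" by auto
      then have "x - u < d x" "v - x < d x" using uv by (auto simp: dist_real_def)
      then have "f v - f u \<le> \<epsilon> * (v - u)"
        using i xk uv by (intro dd) (auto simp: Q_def)
      then show "F i \<le> (case i of (x, k) \<Rightarrow> \<epsilon> * measure lborel k)"
        using uv by (simp add: F_def xk)
    qed
    also have "\<dots> \<le> (\<Sum>(x,k)\<in>p. \<epsilon> * measure lborel k)"
      using fin \<epsilon> by (intro sum_mono2) auto
    also have "\<dots> = \<epsilon> * (\<Sum>(x,k)\<in>p. measure lborel k)"
      by (simp add: sum_distrib_left case_prod_unfold)
    also have "(\<Sum>(x,k)\<in>p. measure lborel k) = b - a"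
      using additive_content_tagged_division[of p a b] p ab by simp
    finally show ?thesis .
  qed
  have bad: "sum F Q < e / 2"
  proof -
    have "sum F Q \<le> (\<Sum>i\<in>Q. norm (f (Sup (snd i)) - f (Inf (snd i))))"
      by (intro sum_mono) (auto simp: F_def)
    also have "\<dots> < e / 2"
    proof (rule ac'[rule_format], intro conjI)
      show "finite Q" by fact
      show "\<forall>i\<in>Q. a \<le> Inf (snd i) \<and> Inf (snd i) \<le> Sup (snd i) \<and> Sup (snd i) \<le> b"
      proof
        fix i assume i: "i \<in> Q"
        obtain u v where "snd i = {u..v}" "u \<le> fst i" "fst i \<le> v" "a \<le> u" "v \<le> b"
          using interval[of "fst i" "snd i"] i Qp by auto
        then show "a \<le> Inf (snd i) \<and> Inf (snd i) \<le> Sup (snd i) \<and> Sup (snd i) \<le> b" by simp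
      qed
      show "disjoint_family_on (\<lambda>i. {Inf (snd i)<..<Sup (snd i)}) Q"
        unfolding disjoint_family_on_def
      proof (intro ballI impI)
        fix i j assume ij: "i \<in> Q" "j \<in> Q" "i \<noteq> j"
        have int: "{Inf (snd i)<..<Sup (snd i)} \<subseteq> interior (snd i)" if iQ: "i \<in> Q" for i
        proof -
          obtain u v where "snd i = {u..v}" "u \<le> fst i" "fst i \<le> v"
            using interval[of "fst i" "snd i"] iQ Qp by auto
          then show ?thesis by simp
        qed
        have "interior (snd i) \<inter> interior (snd j) = {}"
          using tagged_division_ofD(5)[OF p, of "fst i" "snd i" "fst j" "snd j"] ij Qp
          by (auto simp: prod_eq_iff)
        then show "{Inf (snd i)<..<Sup (snd i)} \<inter> {Inf (snd j)<..<Sup (snd j)} = {}"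
          using int[OF ij(1)] int[OF ij(2)] by blast
      qed
      have "(\<Sum>i\<in>Q. Sup (snd i) - Inf (snd i)) = (\<Sum>(x,k)\<in>Q. measure lborel k *\<^sub>R indicator N x)"
      proof (rule sum.cong)
        fix i assume i: "i \<in> Q"
        obtain u v where "snd i = {u..v}" "u \<le> fst i" "fst i \<le> v"
          using interval[of "fst i" "snd i"] i Qp by auto
        then show "Sup (snd i) - Inf (snd i) = (case i of (x, k) \<Rightarrow> measure lborel k *\<^sub>R indicator N x)"
          using i by (auto simp: Q_def case_prod_unfold)
      qed simp
      also have "\<dots> = (\<Sum>(x,k)\<in>p. measure lborel k *\<^sub>R indicator N x)"
        using Qp fin by (intro sum.mono_neutral_left) (auto simp: Q_def indicator_def)
      also have "\<dots> < \<eta>"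
        using small[OF p] fine by (auto simp: fine_Int abs_less_iff)
      finally show "(\<Sum>i\<in>Q. Sup (snd i) - Inf (snd i)) < \<eta>" .
    qed
    finally show ?thesis .
  qed
  have "f b - f a = sum F p"
    using additive_tagged_division_1[OF ab p, of f] by (simp add: F_def)
  also have "\<dots> = sum F (p - Q) + sum F Q"
    using Qp fin by (metis sum.subset_diff)
  also have "\<dots> \<le> \<epsilon> * (b - a) + e / 2" using good bad by simp
  also have "\<dots> \<le> e"
  proof -
    have "\<epsilon> * (b - a) \<le> \<epsilon> * (b - a + 1)" using \<epsilon> by (simp add: algebra_simps)
    also have "\<dots> = e / 2" using ab by (simp add: \<epsilon>_def divide_simps)
    finally show ?thesis by simp
  qed
  finally show "f b \<le> f a + e" by simp
qed

section \<open>Matrices diagonal in a fixed basis\<close>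

text \<open>The product of vectors is componentwise, so this is the conjugated diagonal matrix with
  weights \<open>w\<close> in the eigenbasis of \<open>G0\<close>. As a bilinear map it inherits the
  limit and product rules even when the weights move with time.\<close>

definition diag_apply :: "real^'n^'n \<Rightarrow> real^'n \<Rightarrow> real^'n \<Rightarrow> real^'n" where
  "diag_apply \<Gamma> w x = \<Gamma> *v (w * (matrix_inv \<Gamma> *v x))"

lemma bounded_bilinear_diag_apply: "bounded_bilinear (diag_apply (\<Gamma> :: real^'n^'n))"
  unfolding bilinear_conv_bounded_bilinear[symmetric] bilinear_def diag_apply_def
  by (auto intro!: linearI simp: matrix_vector_right_distrib ring_distribs matrix_vector_mult_scaleR)

lemma matrix_inv_mult:
  fixes \<Gamma> :: "real^'n^'n" assumes "invertible \<Gamma>"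
  shows "\<Gamma> ** matrix_inv \<Gamma> = mat 1" "matrix_inv \<Gamma> ** \<Gamma> = mat 1"
  using matrix_inv_def[of \<Gamma>] someI_ex[OF assms[unfolded invertible_def]] by auto

lemma matrix_inv_mult_vec:
  fixes \<Gamma> :: "real^'n^'n" assumes "invertible \<Gamma>"
  shows "\<Gamma> *v (matrix_inv \<Gamma> *v x) = x" "matrix_inv \<Gamma> *v (\<Gamma> *v x) = x"
  using matrix_inv_mult[OF assms] by (simp_all add: matrix_vector_mul_assoc)

lemma diag_apply_one [simp]: "invertible \<Gamma> \<Longrightarrow> diag_apply \<Gamma> 1 x = x"
  by (simp add: diag_apply_def matrix_inv_mult_vec)

lemma diag_apply_diag_apply:
  "invertible \<Gamma> \<Longrightarrow> diag_apply \<Gamma> v (diag_apply \<Gamma> w x) = diag_apply \<Gamma> (v * w) x"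
  by (simp add: diag_apply_def matrix_inv_mult_vec mult.assoc)

lemma diag_mat_mult_vec: "diag_mat l *v x = l * x"
  by (simp add: diag_mat_def matrix_vector_mult_def vec_eq_iff mult_delta_left)

lemma diag_apply_matrix: "(\<Gamma> ** diag_mat l ** matrix_inv \<Gamma>) *v x = diag_apply \<Gamma> l x"
  by (simp add: diag_apply_def diag_mat_mult_vec flip: matrix_vector_mul_assoc)

lemma mat_pow_diag:
  fixes \<Gamma> :: "real^'n^'n"
  assumes "invertible \<Gamma>"
  shows "mat_pow (\<Gamma> ** diag_mat l ** matrix_inv \<Gamma>) k = \<Gamma> ** diag_mat (\<chi> i. l $ i ^ k) ** matrix_inv \<Gamma>"
proof (induction k)
  case 0
  have "(\<chi> i. l $ i ^ 0) = (1 :: real^'n)" by (simp add: vec_eq_iff)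
  then show ?case
    using assms by (simp add: matrix_eq diag_apply_matrix)
next
  case (Suc k)
  have "l * (\<chi> i. l $ i ^ k) = (\<chi> i. l $ i ^ Suc k)" by (simp add: vec_eq_iff)
  then show ?case
    using assms by (simp add: Suc matrix_eq diag_mat_mult_vec matrix_inv_mult_vec mult.assoc[symmetric]
        flip: matrix_vector_mul_assoc)
qed

text \<open>Conjugating a diagonal matrix is a bounded linear function of its diagonal, so it
  carries the coordinatewise exponential series to the matrix one.\<close>

lemma mat_exp_diag:
  fixes \<Gamma> :: "real^'n^'n"
  assumes "invertible \<Gamma>"
  shows "mat_exp (\<Gamma> ** diag_mat l ** matrix_inv \<Gamma>) = \<Gamma> ** diag_mat (\<chi> i. exp (l $ i)) ** matrix_inv \<Gamma>"
proof -
  define T where "T = (\<lambda>l. \<Gamma> ** diag_mat l ** matrix_inv \<Gamma>)"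
  have lin: "linear T"
    by (rule linearI)
      (auto simp: T_def matrix_eq diag_apply_matrix diag_apply_def matrix_vector_mult_add_rdistrib
         ring_distribs matrix_vector_right_distrib matrix_vector_mult_scaleR scaleR_matrix_vector_assoc[symmetric])
  then have T: "bounded_linear T" by (simp add: linear_conv_bounded_linear)
  have "(\<lambda>k. (1 / fact k) *\<^sub>R (\<chi> i. l $ i ^ k)) sums (\<chi> i. exp (l $ i))"
    unfolding sums_def
  proof (rule vec_tendstoI)
    fix i
    show "(\<lambda>n. (\<Sum>k<n. (1 / fact k) *\<^sub>R (\<chi> i. l $ i ^ k)) $ i) \<longlonglongrightarrow> (\<chi> i. exp (l $ i)) $ i"
      using exp_converges[of "l $ i"] by (simp add: sums_def divide_inverse)
  qed
  from bounded_linear.sums[OF T this]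
  have "(\<lambda>k. (1 / fact k) *\<^sub>R T (\<chi> i. l $ i ^ k)) sums T (\<chi> i. exp (l $ i))"
    by (simp add: linear_scale[OF lin])
  then show ?thesis
    unfolding mat_exp_def using assms by (simp add: mat_pow_diag T_def sums_iff)
qed

lemma dilation_diag:
  assumes "invertible \<Gamma>"
  shows "dilation (\<Gamma> ** diag_mat g ** matrix_inv \<Gamma>) s *v x = diag_apply \<Gamma> (\<chi> i. exp (s * g $ i)) x"
proof -
  have "s *\<^sub>R (\<Gamma> ** diag_mat g ** matrix_inv \<Gamma>) = \<Gamma> ** diag_mat (s *\<^sub>R g) ** matrix_inv \<Gamma>"
    by (simp add: matrix_eq diag_apply_matrix diag_apply_def matrix_vector_mult_scaleR scaleR_matrix_vector_assoc[symmetric])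
  then show ?thesis
    using assms by (simp add: dilation_def mat_exp_diag diag_apply_matrix)
qed

lemma has_vector_derivative_vec_lambda:
  fixes f :: "'n::finite \<Rightarrow> real \<Rightarrow> real"
  assumes "\<And>i. (f i has_real_derivative f' i) (at t)"
  shows "((\<lambda>t. \<chi> i. f i t) has_vector_derivative (\<chi> i. f' i)) (at t)"
proof -
  have *: "(\<chi> i. u i) = (\<Sum>i\<in>UNIV. u i *\<^sub>R axis i 1)" for u :: "'n \<Rightarrow> real"
    by (simp add: vec_eq_iff axis_def if_distrib cong: if_cong)
  show ?thesis unfolding *
    using assms by (auto intro!: derivative_eq_intros simp: has_real_derivative_iff_has_vector_derivative)
qed


section \<open>Quadratic forms\<close>

lemma bounded_bilinear_quadform: "bounded_bilinear (\<lambda>x y. x \<bullet> ((M :: real^'n^'m) *v y))"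
  unfolding bilinear_conv_bounded_bilinear[symmetric] bilinear_def
  by (auto intro!: linearI simp: matrix_vector_right_distrib inner_add_left inner_add_right
      matrix_vector_mult_scaleR)

lemma quadform_coercive:
  fixes M :: "real^'n^'n"
  assumes "\<And>x. x \<noteq> 0 \<Longrightarrow> 0 < x \<bullet> (M *v x)"
  obtains m where "0 < m" "\<And>x. m * (norm x)\<^sup>2 \<le> x \<bullet> (M *v x)"
proof -
  have cont: "continuous_on (sphere 0 1) (\<lambda>x::real^'n. x \<bullet> (M *v x))"
    by (intro continuous_intros linear_continuous_on matrix_vector_mul_bounded_linear)
  have "axis undefined 1 \<in> sphere (0::real^'n) 1" by simp
  then obtain u where u: "u \<in> sphere 0 1" and min: "\<And>x. x \<in> sphere 0 1 \<Longrightarrow> u \<bullet> (M *v u) \<le> x \<bullet> (M *v x)"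
    using continuous_attains_inf[OF compact_sphere _ cont] by blast
  show ?thesis
  proof
    show "0 < u \<bullet> (M *v u)" using u by (intro assms) auto
    fix x :: "real^'n"
    show "u \<bullet> (M *v u) * (norm x)\<^sup>2 \<le> x \<bullet> (M *v x)"
    proof (cases "x = 0")
      case False
      define v where "v = (1 / norm x) *\<^sub>R x"
      have "v \<in> sphere 0 1" using False by (simp add: v_def)
      from min[OF this] have "u \<bullet> (M *v u) * (norm x)\<^sup>2 \<le> (v \<bullet> (M *v v)) * (norm x)\<^sup>2"
        by (rule mult_right_mono) simp
      also have "\<dots> = x \<bullet> (M *v x)"
        using False by (simp add: v_def matrix_vector_mult_scaleR power2_eq_square)
      finally show ?thesis .
    qed simp
  qed
qed

text \<open>Stated for general square matrices because it is applied to \<open>P ** G\<close> and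
  \<open>- (P ** M)\<close>, whose quadratic forms are positive although the matrices need not be
  symmetric.\<close>

lemma quadform_compare:
  fixes M N :: "real^'n^'n"
  assumes M: "\<And>x. x \<noteq> 0 \<Longrightarrow> 0 < x \<bullet> (M *v x)" and N: "\<And>x. x \<noteq> 0 \<Longrightarrow> 0 < x \<bullet> (N *v x)"
  obtains c where "0 < c" "\<And>x. c * (x \<bullet> (M *v x)) \<le> x \<bullet> (N *v x)"
proof -
  obtain m where m: "0 < m" "\<And>x. m * (norm x)\<^sup>2 \<le> x \<bullet> (N *v x)" using quadform_coercive[OF N] by blast
  obtain C where C: "0 < C" "\<And>x y. norm (x \<bullet> (M *v y)) \<le> norm x * norm y * C"
    using bounded_bilinear.pos_bounded[OF bounded_bilinear_quadform] by blast
  show ?thesis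
  proof
    show "0 < m / C" using m C by simp
    fix x
    have "x \<bullet> (M *v x) \<le> C * (norm x)\<^sup>2"
      using C(2)[of x x] by (simp add: power2_eq_square abs_le_iff mult_ac)
    then have "m / C * (x \<bullet> (M *v x)) \<le> m / C * (C * (norm x)\<^sup>2)"
      using m C by (intro mult_left_mono) auto
    also have "\<dots> \<le> x \<bullet> (N *v x)" using m C by simp
    finally show "m / C * (x \<bullet> (M *v x)) \<le> x \<bullet> (N *v x)" .
  qed
qed

section \<open>Monotone dilations\<close>

text \<open>\<open>a\<close> and \<open>b\<close> quantify strict monotonicity: they bound half the
  logarithmic derivative of the squared norm along the dilation, so every growth estimate has the
  form \<open>exp (2 * a * s)\<close> or \<open>exp (2 * b * s)\<close>.\<close>

locale monotone_dilation =
  fixes \<Gamma> P :: "real^'n^'n" and g :: "real^'n" and a b :: real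
  assumes \<Gamma>: "invertible \<Gamma>"
    and P_sym: "transpose P = P"
    and P_pos: "x \<noteq> 0 \<Longrightarrow> 0 < x \<bullet> (P *v x)"
    and a_pos: "0 < a"
    and rate_lower: "a * (x \<bullet> (P *v x)) \<le> x \<bullet> (P *v diag_apply \<Gamma> g x)"
    and rate_upper: "x \<bullet> (P *v diag_apply \<Gamma> g x) \<le> b * (x \<bullet> (P *v x))"
begin

sublocale diag: bounded_bilinear "diag_apply \<Gamma>"
  by (rule bounded_bilinear_diag_apply)

sublocale quad: bounded_bilinear "\<lambda>x y. x \<bullet> (P *v y)"
  by (rule bounded_bilinear_quadform)

definition V :: "real^'n \<Rightarrow> real" where "V x = x \<bullet> (P *v x)"

definition D :: "real \<Rightarrow> real^'n \<Rightarrow> real^'n" where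
  "D s x = diag_apply \<Gamma> (\<chi> i. exp (s * g $ i)) x"

abbreviation G :: "real^'n^'n" where "G \<equiv> \<Gamma> ** diag_mat g ** matrix_inv \<Gamma>"

lemma dilation_eq: "dilation G s *v x = D s x"
  by (simp add: D_def dilation_diag[OF \<Gamma>])

lemma P_commute: "x \<bullet> (P *v y) = y \<bullet> (P *v x)"
  by (metis P_sym dot_lmul_matrix inner_commute transpose_matrix_vector)

lemma V_nonneg: "0 \<le> V x" using P_pos[of x] by (cases "x = 0") (auto simp: V_def)
lemma V_0 [simp]: "V 0 = 0" by (simp add: V_def)
lemma V_eq_0 [simp]: "V x = 0 \<longleftrightarrow> x = 0" using P_pos[of x] by (cases "x = 0") (auto simp: V_def)
lemma V_pos: "x \<noteq> 0 \<Longrightarrow> 0 < V x" using P_pos[of x] by (simp add: V_def)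
lemma wnorm_V: "wnorm P x = sqrt (V x)" by (simp add: wnorm_def V_def)

lemma a_le_b: "a \<le> b"
proof -
  have "a * V (axis undefined 1) \<le> b * V (axis undefined 1)"
    using rate_lower rate_upper unfolding V_def by (rule order_trans)
  then show ?thesis using V_pos[of "axis undefined 1"] by (simp add: axis_eq_0_iff)
qed

lemma D_0 [simp]: "D 0 x = x"
proof -
  have "(\<chi> i. exp (0 * g $ i)) = (1 :: real^'n)" by (simp add: vec_eq_iff)
  then show ?thesis using \<Gamma> by (simp add: D_def)
qed

lemma D_add: "D s (D t x) = D (s + t) x"
proof -
  have "(\<chi> i. exp (s * g $ i)) * (\<chi> i. exp (t * g $ i)) = (\<chi> i. exp ((s + t) * g $ i))"
    by (simp add: vec_eq_iff ring_distribs exp_add)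
  then show ?thesis using \<Gamma> by (simp add: D_def diag_apply_diag_apply)
qed

lemma D_minus [simp]: "D (-s) (D s x) = x" "D s (D (-s) x) = x"
  by (simp_all add: D_add)

lemma D_zero [simp]: "D s 0 = 0"
  by (simp add: D_def diag.zero_right)

lemma D_eq_0 [simp]: "D s x = 0 \<longleftrightarrow> x = 0"
  by (metis D_minus(1) D_zero)

lemma linear_D: "linear (D s)"
  unfolding D_def by (simp add: diag.bounded_linear_right bounded_linear.linear)

lemma D_diag_commute: "D s (diag_apply \<Gamma> w x) = diag_apply \<Gamma> w (D s x)"
  unfolding D_def using \<Gamma> by (simp add: diag_apply_diag_apply mult.commute)

lemma tendsto_D [tendsto_intros]:
  "(f \<longlongrightarrow> s) F \<Longrightarrow> (h \<longlongrightarrow> x) F \<Longrightarrow> ((\<lambda>t. D (f t) (h t)) \<longlongrightarrow> D s x) F"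
  unfolding D_def by (intro diag.tendsto tendsto_intros)

lemma tendsto_V [tendsto_intros]: "(h \<longlongrightarrow> x) F \<Longrightarrow> ((\<lambda>t. V (h t)) \<longlongrightarrow> V x) F"
  unfolding V_def by (rule quad.tendsto)

section \<open>Growth of the squared norm along the dilation\<close>

lemma D_has_vector_derivative:
  assumes \<sigma>: "(\<sigma> has_real_derivative \<sigma>') (at t)" and x: "(x has_vector_derivative x') (at t)"
  shows "((\<lambda>t. D (\<sigma> t) (x t)) has_vector_derivative
    (D (\<sigma> t) x' + \<sigma>' *\<^sub>R diag_apply \<Gamma> g (D (\<sigma> t) (x t)))) (at t)"
proof -
  have "((\<lambda>t. \<chi> i. exp (\<sigma> t * g $ i)) has_vector_derivative (\<chi> i. exp (\<sigma> t * g $ i) * (\<sigma>' * g $ i))) (at t)"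
    using \<sigma> by (intro has_vector_derivative_vec_lambda) (auto intro!: derivative_eq_intros)
  from diag.has_vector_derivative[OF this x]
  have "((\<lambda>t. D (\<sigma> t) (x t)) has_vector_derivative (D (\<sigma> t) x' +
      diag_apply \<Gamma> (\<chi> i. exp (\<sigma> t * g $ i) * (\<sigma>' * g $ i)) (x t))) (at t)"
    unfolding D_def .
  moreover have "(\<chi> i. exp (\<sigma> t * g $ i) * (\<sigma>' * g $ i)) = \<sigma>' *\<^sub>R (g * (\<chi> i. exp (\<sigma> t * g $ i)))"
    by (simp add: vec_eq_iff)
  ultimately show ?thesis
    using \<Gamma> by (simp add: D_def diag_apply_diag_apply diag.scaleR_left)
qed

lemma V_has_real_derivative:
  assumes z: "(z has_vector_derivative z') (at t)"
  shows "((\<lambda>t. V (z t)) has_real_derivative 2 * (z t \<bullet> (P *v z'))) (at t)"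
  using quad.has_vector_derivative[OF z z] P_commute[of z' "z t"]
  by (simp add: V_def has_real_derivative_iff_has_vector_derivative)

lemma V_D_has_real_derivative:
  "((\<lambda>s. V (D s x)) has_real_derivative 2 * (D s x \<bullet> (P *v diag_apply \<Gamma> g (D s x)))) (at s)"
  using V_has_real_derivative[OF D_has_vector_derivative[OF DERIV_ident has_vector_derivative_const]]
  by (simp add: linear_0[OF linear_D])

text \<open>\<open>exp (- 2 * a * s)\<close> is the integrating factor of the differential
  inequality that \<open>rate_lower\<close> gives.\<close>

lemma V_D_lower: assumes "0 \<le> s" shows "exp (2 * a * s) * V x \<le> V (D s x)"
proof -
  have "exp (- 2 * a * 0) * V (D 0 x) \<le> exp (- 2 * a * s) * V (D s x)"
  proof (rule DERIV_nonneg_imp_nondecreasing[OF assms])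
    fix t
    have "((\<lambda>s. exp (- 2 * a * s) * V (D s x)) has_real_derivative
      (exp (- 2 * a * t) * (2 * (D t x \<bullet> (P *v diag_apply \<Gamma> g (D t x)) - a * V (D t x))))) (at t)"
      by (auto intro!: derivative_eq_intros V_D_has_real_derivative simp: algebra_simps)
    moreover have "0 \<le> exp (- 2 * a * t) * (2 * (D t x \<bullet> (P *v diag_apply \<Gamma> g (D t x)) - a * V (D t x)))"
      using rate_lower[of "D t x"] by (simp add: V_def)
    ultimately show "\<exists>y. ((\<lambda>s. exp (- 2 * a * s) * V (D s x)) has_real_derivative y) (at t) \<and> 0 \<le> y"
      by blast
  qed
  then show ?thesis by (simp add: exp_minus field_simps)
qed

lemma V_D_upper: assumes "0 \<le> s" shows "V (D s x) \<le> exp (2 * b * s) * V x"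
proof -
  have "exp (- 2 * b * s) * V (D s x) \<le> exp (- 2 * b * 0) * V (D 0 x)"
  proof (rule DERIV_nonpos_imp_nonincreasing[OF assms])
    fix t
    have "((\<lambda>s. exp (- 2 * b * s) * V (D s x)) has_real_derivative
      (exp (- 2 * b * t) * (2 * (D t x \<bullet> (P *v diag_apply \<Gamma> g (D t x)) - b * V (D t x))))) (at t)"
      by (auto intro!: derivative_eq_intros V_D_has_real_derivative simp: algebra_simps)
    moreover have "exp (- 2 * b * t) * (2 * (D t x \<bullet> (P *v diag_apply \<Gamma> g (D t x)) - b * V (D t x))) \<le> 0"
      using rate_upper[of "D t x"] by (simp add: V_def mult_le_0_iff)
    ultimately show "\<exists>y. ((\<lambda>s. exp (- 2 * b * s) * V (D s x)) has_real_derivative y) (at t) \<and> y \<le> 0"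
      by blast
  qed
  then show ?thesis by (simp add: exp_minus field_simps)
qed

text \<open>A negative dilation is undone by a positive one, so the growth bounds return with
  \<open>a\<close> and \<open>b\<close> exchanged.\<close>

lemma V_D_neg:
  assumes "s \<le> 0"
  shows "exp (2 * b * s) * V x \<le> V (D s x)" "V (D s x) \<le> exp (2 * a * s) * V x"
  using V_D_lower[of "-s" "D s x"] V_D_upper[of "-s" "D s x"] assms
  by (simp_all add: exp_minus field_simps)

lemma V_D_less: assumes "x \<noteq> 0" "s < t" shows "V (D s x) < V (D t x)"
proof -
  have "V (D s x) < exp (2 * a * (t - s)) * V (D s x)"
    using assms a_pos V_pos[of "D s x"] by simp
  also have "\<dots> \<le> V (D (t - s) (D s x))" using assms by (intro V_D_lower) simp
  finally show ?thesis by (simp add: D_add)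
qed

lemma V_sublevel_neg:
  assumes "\<sigma> \<le> 0" "V (D (- \<sigma>) x) \<le> 1" shows "V x \<le> exp (2 * a * \<sigma>)"
proof -
  have "V x \<le> exp (2 * a * \<sigma>) * V (D (- \<sigma>) x)" using V_D_neg(2)[OF assms(1), of "D (- \<sigma>) x"] by simp
  also have "\<dots> \<le> exp (2 * a * \<sigma>) * 1" using assms(2) by (intro mult_left_mono) auto
  finally show ?thesis by simp
qed

lemma V_sublevel_pos:
  assumes "0 \<le> \<sigma>" "V (D (- \<sigma>) x) \<le> 1" shows "V x \<le> exp (2 * b * \<sigma>)"
proof -
  have "V x \<le> exp (2 * b * \<sigma>) * V (D (- \<sigma>) x)" using V_D_upper[OF assms(1), of "D (- \<sigma>) x"] by simp
  also have "\<dots> \<le> exp (2 * b * \<sigma>) * 1" using assms(2) by (intro mult_left_mono) auto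
  finally show ?thesis by simp
qed

text \<open>The bound \<open>exp (2 * a * \<sigma>)\<close> of \<open>V_sublevel_neg\<close>
  vanishes as \<open>\<sigma>\<close> tends to minus infinity. This is how arrival at the origin is
  read off the barriers.\<close>

lemma eq_0_if_V_sublevels:
  assumes "\<And>\<sigma>. \<sigma> \<le> 0 \<Longrightarrow> V (D (- \<sigma>) x) \<le> 1" shows "x = 0"
proof (rule ccontr)
  assume "x \<noteq> 0"
  then have pos: "0 < V x" by (rule V_pos)
  define \<sigma> where "\<sigma> = min 0 (ln (V x) / (2 * a) - 1)"
  have "2 * a * \<sigma> \<le> 2 * a * (ln (V x) / (2 * a) - 1)"
    using a_pos by (intro mult_left_mono) (auto simp: \<sigma>_def)
  also have "\<dots> < ln (V x)" using a_pos by (simp add: right_diff_distrib)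
  finally have "exp (2 * a * \<sigma>) < exp (ln (V x))" by (simp only: exp_less_cancel_iff)
  moreover have "V x \<le> exp (2 * a * \<sigma>)" by (intro V_sublevel_neg assms) (auto simp: \<sigma>_def)
  ultimately show False using pos \<open>x \<noteq> 0\<close> by simp
qed

text \<open>Away from the origin this is the logarithm of \<open>hom_norm P G\<close>; in this
  variable a dilation acts as a translation.\<close>

definition log_norm :: "real^'n \<Rightarrow> real" where
  "log_norm x = (THE s. wnorm P (dilation G (- s) *v x) = 1)"

lemma log_norm_unique:
  assumes "V (D (- s) x) = 1" shows "log_norm x = s"
  unfolding log_norm_def dilation_eq wnorm_V
proof (rule the_equality)
  show "sqrt (V (D (- s) x)) = 1" using assms by simp
  fix t assume "sqrt (V (D (- t) x)) = 1"
  moreover have "x \<noteq> 0" using assms by auto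
  ultimately show "t = s"
    using V_D_less[of x "-s" "-t"] V_D_less[of x "-t" "-s"] assms
    by (cases s t rule: linorder_cases) auto
qed

text \<open>The growth bounds put the value 1 between the parameters 0 and
  \<open>ln (V x) / (2 * a)\<close>, and the intermediate value theorem finds it. The second
  conjunct records this location; it replaces any implicit-function argument for the continuity of
  \<open>log_norm\<close> at the unit sphere.\<close>

lemma log_norm_exists:
  assumes "x \<noteq> 0"
  shows "\<exists>s. V (D (- s) x) = 1 \<and> 2 * a * \<bar>s\<bar> \<le> \<bar>ln (V x)\<bar>"
proof -
  define r where "r = ln (V x) / (2 * a)"
  have r: "2 * a * r = ln (V x)" using a_pos by (simp add: r_def)
  have V: "0 < V x" using assms by (rule V_pos)
  have cont: "isCont (\<lambda>s. V (D (- s) x)) s" for s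
    unfolding isCont_def by (intro tendsto_intros)
  show ?thesis
  proof (cases "1 \<le> V x")
    case True
    then have r0: "0 \<le> r" using a_pos by (simp add: r_def)
    have "V (D (- r) x) \<le> exp (2 * a * (- r)) * V x" using r0 by (intro V_D_neg) simp
    also have "\<dots> = 1" using r V assms by (simp add: exp_minus)
    finally obtain s where "0 \<le> s" "s \<le> r" "V (D (- s) x) = 1"
      using IVT2[of "\<lambda>s. V (D (- s) x)" r 1 0] True r0 cont by auto
    then show ?thesis using r a_pos mult_left_mono[of s r "2 * a"] by (intro exI[of _ s]) auto
  next
    case False
    then have r0: "r \<le> 0" using a_pos V by (simp add: r_def field_simps)
    have "1 = exp (2 * a * (- r)) * V x" using r V assms by (simp add: exp_minus)
    also have "\<dots> \<le> V (D (- r) x)" using r0 by (intro V_D_lower) simp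
    finally obtain s where "r \<le> s" "s \<le> 0" "V (D (- s) x) = 1"
      using IVT2[of "\<lambda>s. V (D (- s) x)" 0 1 r] False r0 cont by auto
    then show ?thesis using r a_pos mult_left_mono[of r s "2 * a"] by (intro exI[of _ s]) auto
  qed
qed

lemma V_log_norm: "x \<noteq> 0 \<Longrightarrow> V (D (- log_norm x) x) = 1"
  using log_norm_exists log_norm_unique by metis

lemma log_norm_bound: "x \<noteq> 0 \<Longrightarrow> 2 * a * \<bar>log_norm x\<bar> \<le> \<bar>ln (V x)\<bar>"
  using log_norm_exists log_norm_unique by metis

lemma log_norm_D: "x \<noteq> 0 \<Longrightarrow> log_norm (D r x) = r + log_norm x"
  using V_log_norm[of x] by (intro log_norm_unique) (simp add: D_add)

text \<open>Continuity on the unit sphere is enough, since \<open>hom_term_D\<close> moves every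
  question about the homogeneous term to that sphere.\<close>

lemma log_norm_tendsto:
  assumes "V l = 1" shows "(log_norm \<longlongrightarrow> 0) (at l)"
proof (rule Lim_null_comparison)
  have "l \<noteq> 0" using assms by auto
  then have "\<forall>\<^sub>F y in at l. y \<noteq> 0" by (simp add: eventually_neq_at_within)
  then show "\<forall>\<^sub>F y in at l. norm (log_norm y) \<le> \<bar>ln (V y)\<bar> / (2 * a)"
  proof eventually_elim
    case (elim y)
    then show ?case using a_pos log_norm_bound[of y] by (simp add: field_simps)
  qed
  have "((\<lambda>y. \<bar>ln (V y)\<bar> / (2 * a)) \<longlongrightarrow> \<bar>ln (V l)\<bar> / (2 * a)) (at l)"
    using assms a_pos by (intro tendsto_intros) auto
  then show "((\<lambda>y. \<bar>ln (V y)\<bar> / (2 * a)) \<longlongrightarrow> 0) (at l)" using assms by simp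
qed

lemma hom_term_eq:
  "x \<noteq> 0 \<Longrightarrow> hom_term K P G \<mu> x =
     exp ((1 + \<mu>) * log_norm x) *\<^sub>R (K *v D (- log_norm x) x)"
  by (simp add: hom_term_def hom_norm_def dilation_eq powr_def log_norm_def)

text \<open>\<open>log_norm\<close> shifts by \<open>s\<close>, which cancels in the projection to
  the sphere. Since the dilation multiplies the range of \<open>B\<close> by \<open>exp s\<close>,
  the factor \<open>exp ((1 + \<mu>) * s)\<close> makes \<open>B\<close> times this term homogeneous
  of degree \<open>\<mu>\<close>.\<close>

lemma hom_term_D:
  "hom_term K P G \<mu> (D s x) = exp ((1 + \<mu>) * s) *\<^sub>R hom_term K P G \<mu> x"
proof (cases "x = 0")
  case False
  then show ?thesis by (simp add: hom_term_eq log_norm_D D_add ring_distribs exp_add)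
qed (simp add: hom_term_def)

text \<open>The limit depends neither on \<open>\<mu>\<close> nor on the dilation, so the two
  branches of the feedback agree in the limit at the unit sphere.\<close>

lemma hom_term_tendsto:
  assumes l: "V l = 1" and y: "(y \<longlongrightarrow> l) F"
  shows "((\<lambda>n. hom_term K P G \<mu> (y n)) \<longlongrightarrow> K *v l) F"
proof -
  have l0: "l \<noteq> 0" using l by auto
  have ll: "log_norm l = 0" using l by (intro log_norm_unique) simp
  have "isCont log_norm l" using log_norm_tendsto[OF l] by (simp add: isCont_def ll)
  then have "((\<lambda>n. log_norm (y n)) \<longlongrightarrow> log_norm l) F" using y by (rule isCont_tendsto_compose)
  then have "((\<lambda>n. exp ((1 + \<mu>) * log_norm (y n)) *\<^sub>R (K *v D (- log_norm (y n)) (y n)))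
      \<longlongrightarrow> exp ((1 + \<mu>) * log_norm l) *\<^sub>R (K *v D (- log_norm l) l)) F"
    using y by (intro tendsto_intros bounded_linear.tendsto[OF matrix_vector_mul_bounded_linear])
  moreover have "\<forall>\<^sub>F n in F. y n \<noteq> 0"
    using y l0 by (rule tendsto_imp_eventually_ne)
  ultimately show ?thesis
    by (simp add: ll) (erule Lim_transform_eventually, erule eventually_mono, simp add: hom_term_eq)
qed

end

section \<open>The barrier argument\<close>

text \<open>\<open>S\<close> is the range of \<open>\<sigma>\<close> in which the dilation is used: \<open>{0..}\<close> outside the unit ball and \<open>{..0}\<close>
  inside it.\<close>

locale homogeneous_stage = monotone_dilation \<Gamma> P g a b
  for \<Gamma> P :: "real^'n^'n" and g a b +
  fixes f :: "real^'n \<Rightarrow> real^'n" and M :: "real^'n^'n" and \<mu> \<eta> \<kappa> \<rho> :: real and S :: "real set"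
  assumes \<eta>: "0 < \<eta>" and \<kappa>: "0 < \<kappa>" and \<rho>: "0 < \<rho>"
    and near: "\<lbrakk>\<sigma> \<in> S; 1 \<le> V z; V z \<le> 1 + \<eta>\<rbrakk>
      \<Longrightarrow> norm (exp (- \<mu> * \<sigma>) *\<^sub>R D (- \<sigma>) (f (D \<sigma> z)) - M *v z) \<le> \<kappa>"
    and margin: "\<lbrakk>1 \<le> V z; V z \<le> 1 + \<eta>; norm (w - M *v z) \<le> 2 * \<kappa>\<rbrakk> \<Longrightarrow> z \<bullet> (P *v w) \<le> - \<rho>"
begin

text \<open>A closed convex set containing the values of \<open>f\<close> near \<open>x\<close>
  contains the Filippov set. Such a set is the preimage \<open>C\<close> of a ball under the
  rescaling \<open>T\<close>. One \<open>\<kappa>\<close> of its radius is the bound in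
  \<open>near\<close>, the other absorbs the change of \<open>M *v D (- \<sigma>) y\<close> for
  \<open>y\<close> near \<open>x\<close>.\<close>

lemma filippov_decrease:
  assumes \<sigma>: "\<sigma> \<in> S" and z: "1 < V (D (- \<sigma>) x)" "V (D (- \<sigma>) x) < 1 + \<eta>"
    and v: "v \<in> filippov_map f x"
  shows "D (- \<sigma>) x \<bullet> (P *v D (- \<sigma>) v) \<le> - \<rho> * exp (\<mu> * \<sigma>)"
proof -
  define T where "T = (\<lambda>w. exp (- \<mu> * \<sigma>) *\<^sub>R D (- \<sigma>) w)"
  have T: "linear T" unfolding T_def
    by (rule linear_compose_scale_right) (rule linear_D)
  define m where "m = M *v D (- \<sigma>) x"
  define C where "C = T -` cball m (2 * \<kappa>)"
  have lim: "((\<lambda>y. D (- \<sigma>) y) \<longlongrightarrow> D (- \<sigma>) x) (nhds x)"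
    by (intro tendsto_intros filterlim_ident)
  have "((\<lambda>y. M *v D (- \<sigma>) y) \<longlongrightarrow> m) (nhds x)"
    unfolding m_def using lim by (rule bounded_linear.tendsto[OF matrix_vector_mul_bounded_linear])
  then have "\<forall>\<^sub>F y in nhds x. dist (M *v D (- \<sigma>) y) m < \<kappa>"
    using \<kappa> by (rule tendstoD)
  moreover have "\<forall>\<^sub>F y in nhds x. 1 < V (D (- \<sigma>) y)" "\<forall>\<^sub>F y in nhds x. V (D (- \<sigma>) y) < 1 + \<eta>"
    using order_tendstoD[OF tendsto_V[OF lim]] z by auto
  ultimately have "\<forall>\<^sub>F y in nhds x. f y \<in> C"
  proof eventually_elim
    case (elim y)
    have "norm (T (f (D \<sigma> (D (- \<sigma>) y))) - M *v D (- \<sigma>) y) \<le> \<kappa>"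
      unfolding T_def using elim by (intro near \<sigma>) auto
    moreover have "norm (T (f y) - m) \<le> norm (T (f y) - M *v D (- \<sigma>) y) + norm (M *v D (- \<sigma>) y - m)"
      by norm
    ultimately show ?case
      using elim by (simp add: C_def dist_norm norm_minus_commute)
  qed
  then obtain \<epsilon> where \<epsilon>: "0 < \<epsilon>" and "\<And>y. dist y x < \<epsilon> \<Longrightarrow> f y \<in> C"
    unfolding eventually_nhds_metric by blast
  then have sub: "f ` ball x \<epsilon> \<subseteq> C" by (auto simp: dist_commute)
  \<comment> \<open>The intersection defining the Filippov set is used at this
    \<open>\<epsilon>\<close> with the empty null set, because \<open>f\<close> takes values in
    \<open>C\<close> on the whole ball.\<close>
  have "v \<in> closure (convex hull (f ` (ball x \<epsilon> - {})))"
    using v \<epsilon> unfolding filippov_map_def by blast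
  also have "\<dots> \<subseteq> C"
  proof (intro closure_minimal hull_minimal)
    show "f ` (ball x \<epsilon> - {}) \<subseteq> C" using sub by simp
    show "convex C" unfolding C_def using T by (intro convex_linear_vimage) auto
    show "closed C" unfolding C_def
      using linear_continuous_on[OF linear_conv_bounded_linear[THEN iffD1, OF T]]
      by (intro continuous_closed_vimage) (auto simp: continuous_on_eq_continuous_within)
  qed
  finally have "norm (T v - M *v D (- \<sigma>) x) \<le> 2 * \<kappa>"
    by (simp add: C_def m_def dist_norm norm_minus_commute)
  then have "D (- \<sigma>) x \<bullet> (P *v T v) \<le> - \<rho>" using z by (intro margin) auto
  then show ?thesis
    by (simp add: T_def matrix_vector_mult_scaleR exp_minus field_simps)
qed

text \<open>If \<open>\<phi> = V (D (- \<sigma> t) (x t))\<close> exceeded 1, it would pass through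
  values in \<open>(1, 1 + \<eta>)\<close>. There the inward drift
  \<open>- \<rho> * exp (\<mu> * \<sigma>)\<close> outweighs the growth caused by shrinking the
  level, at most \<open>- \<sigma>' * b * (1 + \<eta>)\<close>; this is the balance stated in
  \<open>slow\<close>. Hence \<open>\<phi>\<close> cannot increase.\<close>

lemma sublevel_invariant:
  assumes sol: "filippov_solution f x0 x" and t: "0 \<le> t0" "t0 \<le> t1"
    and der: "\<And>t. t \<in> {t0..t1} \<Longrightarrow> (\<sigma> has_real_derivative \<sigma>' t) (at t)"
    and cont: "continuous_on {t0..t1} \<sigma>'"
    and S: "\<And>t. t \<in> {t0..t1} \<Longrightarrow> \<sigma> t \<in> S"
    and slow: "\<And>t. t \<in> {t0..t1} \<Longrightarrow> - \<sigma>' t * (b * (1 + \<eta>)) \<le> \<rho> * exp (\<mu> * \<sigma> t)"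
    and init: "V (D (- \<sigma> t0) (x t0)) \<le> 1"
    and t2: "t2 \<in> {t0..t1}"
  shows "V (D (- \<sigma> t2) (x t2)) \<le> 1"
proof (rule ccontr)
  define \<phi> where "\<phi> = (\<lambda>t. V (D (- \<sigma> t) (x t)))"
  define e where "e = (\<lambda>t. \<chi> i. exp (- \<sigma> t * g $ i))"
  define e' where "e' = (\<lambda>t. \<chi> i. exp (- \<sigma> t * g $ i) * (- \<sigma>' t * g $ i))"
  have "abs_continuous_on_ivl 0 (t1 + 1) x"
    using sol t unfolding filippov_solution_def by auto
  then have acx: "abs_continuous_on_ivl t0 t1 x"
    by (rule abs_continuous_on_ivl_subset) (use t in auto)
  have e: "(e has_vector_derivative e' t) (at t)" if "t \<in> {t0..t1}" for t
    unfolding e_def e'_def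
    by (intro has_vector_derivative_vec_lambda) (auto intro!: derivative_eq_intros der[OF that])
  have \<sigma>_cont: "continuous_on {t0..t1} \<sigma>"
    by (intro continuous_at_imp_continuous_on ballI) (rule DERIV_isCont, rule der)
  then have "continuous_on {t0..t1} e'"
    unfolding e'_def using cont by (intro continuous_intros)
  then have "bounded (e' ` {t0..t1})"
    by (intro compact_imp_bounded compact_continuous_image) auto
  then obtain L where L: "\<And>t. t \<in> {t0..t1} \<Longrightarrow> norm (e' t) \<le> L"
    unfolding bounded_iff by blast
  \<comment> \<open>The weights have a bounded derivative, hence are Lipschitz. Absolute continuity
    then passes through the two bilinear maps to \<open>\<phi>\<close>.\<close>
  have ace: "abs_continuous_on_ivl t0 t1 e"
  proof (rule abs_continuous_on_ivl_lipschitz)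
    fix s t assume st: "t0 \<le> s" "s \<le> t" "t \<le> t1"
    have "norm (e t - e s) \<le> L * norm (t - s)"
    proof (rule differentiable_bound[of "{t0..t1}"])
      fix u assume u: "u \<in> {t0..t1}"
      show "(e has_derivative (\<lambda>h. h *\<^sub>R e' u)) (at u within {t0..t1})"
        using e[OF u] by (auto simp: has_vector_derivative_def intro: has_derivative_at_withinI)
      show "onorm (\<lambda>h. h *\<^sub>R e' u) \<le> L"
        using L[OF u] by (intro onorm_le) (simp add: mult.commute[of L] mult_left_mono)
    qed (use st in auto)
    then show "norm (e t - e s) \<le> L * (t - s)" using st by simp
  qed
  have acz: "abs_continuous_on_ivl t0 t1 (\<lambda>t. D (- \<sigma> t) (x t))"
    using diag.abs_continuous_on_ivl[OF ace acx] by (simp add: D_def e_def)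
  have ac\<phi>: "abs_continuous_on_ivl t0 t1 \<phi>"
    using quad.abs_continuous_on_ivl[OF acz acz] by (simp add: \<phi>_def V_def)
  have \<phi>_cont: "continuous_on {t0..t1} \<phi>"
    by (rule abs_continuous_on_ivl_imp_continuous[OF ac\<phi>])
  have "AE t in lebesgue. t > 0 \<longrightarrow> (\<exists>v \<in> filippov_map f (x t). (x has_vector_derivative v) (at t))"
    using sol unfolding filippov_solution_def by blast
  then obtain N where N: "N \<in> null_sets lebesgue"
    and sub: "{t \<in> space lebesgue. \<not> (t > 0 \<longrightarrow>
      (\<exists>v \<in> filippov_map f (x t). (x has_vector_derivative v) (at t)))} \<subseteq> N"
    unfolding eventually_ae_filter by blast
  have xN: "\<exists>v \<in> filippov_map f (x t). (x has_vector_derivative v) (at t)" if "t > 0" "t \<notin> N" for t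
    using sub that by auto
  have negl: "negligible N" using N by (simp add: negligible_iff_null_sets)
  have b: "0 < b" using a_pos a_le_b by simp
  have decr: "\<exists>D\<le>0. (\<phi> has_real_derivative D) (at t)"
    if t': "t \<in> {t0<..<t1}" "t \<notin> N" and \<phi>t: "1 < \<phi> t" "\<phi> t < 1 + \<eta>" for t
  proof -
    define z where "z = D (- \<sigma> t) (x t)"
    have tt: "t \<in> {t0..t1}" using t' by auto
    obtain v where v: "v \<in> filippov_map f (x t)" "(x has_vector_derivative v) (at t)"
      using xN[of t] t' t by auto
    have "((\<lambda>t. D (- \<sigma> t) (x t)) has_vector_derivative
        (D (- \<sigma> t) v + (- \<sigma>' t) *\<^sub>R diag_apply \<Gamma> g z)) (at t)"
      unfolding z_def by (intro D_has_vector_derivative DERIV_minus der tt v)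
    from V_has_real_derivative[OF this]
    have "(\<phi> has_real_derivative 2 * (z \<bullet> (P *v (D (- \<sigma> t) v + (- \<sigma>' t) *\<^sub>R diag_apply \<Gamma> g z)))) (at t)"
      by (simp only: \<phi>_def z_def)
    moreover have "z \<bullet> (P *v D (- \<sigma> t) v) \<le> - \<rho> * exp (\<mu> * \<sigma> t)"
      unfolding z_def using \<phi>t v S[OF tt] by (intro filippov_decrease) (auto simp: \<phi>_def)
    \<comment> \<open>A rising level helps, by \<open>rate_lower\<close>; for a falling one
      \<open>rate_upper\<close> and \<open>\<phi> t < 1 + \<eta>\<close> reduce the claim to
      \<open>slow\<close>.\<close>
    moreover have "- \<sigma>' t * (z \<bullet> (P *v diag_apply \<Gamma> g z)) \<le> \<rho> * exp (\<mu> * \<sigma> t)"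
    proof (cases "0 \<le> \<sigma>' t")
      case True
      have "0 \<le> a * V z" using a_pos V_nonneg by simp
      then have "0 \<le> z \<bullet> (P *v diag_apply \<Gamma> g z)" using rate_lower[of z] by (simp add: V_def)
      then have "- \<sigma>' t * (z \<bullet> (P *v diag_apply \<Gamma> g z)) \<le> 0" using True by simp
      also have "0 \<le> \<rho> * exp (\<mu> * \<sigma> t)" using \<rho> by simp
      finally show ?thesis .
    next
      case False
      have "z \<bullet> (P *v diag_apply \<Gamma> g z) \<le> b * V z" using rate_upper[of z] by (simp add: V_def)
      also have "\<dots> \<le> b * (1 + \<eta>)" using b \<phi>t by (simp add: \<phi>_def z_def)
      finally have "- \<sigma>' t * (z \<bullet> (P *v diag_apply \<Gamma> g z)) \<le> - \<sigma>' t * (b * (1 + \<eta>))"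
        using False by (intro mult_left_mono) auto
      also have "\<dots> \<le> \<rho> * exp (\<mu> * \<sigma> t)" by (rule slow[OF tt])
      finally show ?thesis .
    qed
    moreover have "z \<bullet> (P *v (D (- \<sigma> t) v + (- \<sigma>' t) *\<^sub>R diag_apply \<Gamma> g z))
        = z \<bullet> (P *v D (- \<sigma> t) v) - \<sigma>' t * (z \<bullet> (P *v diag_apply \<Gamma> g z))"
      by (simp add: matrix_vector_right_distrib matrix_vector_mult_scaleR quad.minus_right quad.scaleR_right quad.add_right quad.diff_right)
    ultimately show ?thesis
      by (intro exI[of _ "2 * (z \<bullet> (P *v (D (- \<sigma> t) v + (- \<sigma>' t) *\<^sub>R diag_apply \<Gamma> g z)))"]) simp
  qed
  assume "\<not> V (D (- \<sigma> t2) (x t2)) \<le> 1"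
  then have \<phi>t2: "1 < \<phi> t2" by (simp add: \<phi>_def)
  \<comment> \<open>The last time before \<open>t2\<close> with \<open>\<phi> \<le> 1\<close> is the
    maximum of this compact set; after it \<open>\<phi>\<close> stays above 1 up to
    \<open>t2\<close>.\<close>
  define Z where "Z = {t \<in> {t0..t2}. \<phi> t \<le> 1}"
  have "continuous_on {t0..t2} \<phi>" using \<phi>_cont t2 by (auto intro: continuous_on_subset)
  then have "closed Z"
    unfolding Z_def by (intro continuous_on_closed_Collect_le continuous_intros) auto
  moreover have "bounded Z" by (rule bounded_subset[of "{t0..t2}"]) (auto simp: Z_def)
  ultimately have "compact Z" by (simp add: compact_eq_bounded_closed)
  moreover have "t0 \<in> Z" using init t2 by (auto simp: Z_def \<phi>_def)
  ultimately obtain \<tau> where \<tau>: "\<tau> \<in> Z" "\<And>t. t \<in> Z \<Longrightarrow> t \<le> \<tau>"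
    using compact_attains_sup[of Z] by blast
  have \<tau>': "t0 \<le> \<tau>" "\<tau> < t2" "\<phi> \<tau> \<le> 1"
    using \<tau>(1) \<phi>t2 by (auto simp: Z_def less_le)
  have above: "1 < \<phi> t" if "\<tau> < t" "t \<le> t2" for t
    using \<tau>(2)[of t] that \<tau>' by (force simp: Z_def)
  have "\<tau> \<in> {t0..t1}" using \<tau>' t2 by auto
  then obtain d where d: "0 < d" and dd: "\<And>t. t \<in> {t0..t1} \<Longrightarrow> dist t \<tau> < d \<Longrightarrow> dist (\<phi> t) (\<phi> \<tau>) < \<eta>"
    using \<phi>_cont \<eta> unfolding continuous_on_iff by blast
  \<comment> \<open>So close to \<open>\<tau>\<close> that continuity keeps \<open>\<phi>\<close>
    below \<open>1 + \<eta>\<close>, where \<open>decr\<close> applies.\<close>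
  define \<tau>1 where "\<tau>1 = min t2 (\<tau> + d / 2)"
  have \<tau>1: "\<tau> < \<tau>1" "\<tau>1 \<le> t2" "\<tau>1 - \<tau> < d" using d \<tau>' by (auto simp: \<tau>1_def)
  have "\<phi> \<tau>1 \<le> \<phi> \<tau>"
  proof (rule abs_continuous_nonincreasing[where f=\<phi> and E=N, OF _ _ negl])
    show "abs_continuous_on_ivl \<tau> \<tau>1 \<phi>"
      using ac\<phi> by (rule abs_continuous_on_ivl_subset) (use \<tau>' \<tau>1 t2 in auto)
    fix t assume t': "\<tau> < t" "t < \<tau>1" "t \<notin> N"
    have "dist (\<phi> t) (\<phi> \<tau>) < \<eta>"
      using t' \<tau>1 \<tau>' t2 by (intro dd) (auto simp: dist_real_def)
    then have "\<phi> t < 1 + \<eta>" using \<tau>' by (auto simp: dist_real_def)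
    then show "\<exists>D\<le>0. (\<phi> has_real_derivative D) (at t)"
      using t' \<tau>1 \<tau>' t2 above[of t] by (intro decr) auto
  qed (use \<tau>1 in simp)
  then show False using above[of \<tau>1] \<tau>1 \<tau>' by simp
qed

lemma sublevel_invariant_const:
  assumes sol: "filippov_solution f x0 x" and t: "0 \<le> t0" "t0 \<le> t"
    and S: "\<sigma> \<in> S" and init: "V (D (- \<sigma>) (x t0)) \<le> 1"
  shows "V (D (- \<sigma>) (x t)) \<le> 1"
  using sublevel_invariant[OF sol t, of "\<lambda>_. \<sigma>" "\<lambda>_. 0" t] S init t \<rho> by auto

end

section \<open>The quantized feedback near the unit sphere\<close>

context monotone_dilation
begin

lemma V_sublevel_bounded:
  obtains R where "0 < R" "\<And>z. V z \<le> c \<Longrightarrow> norm z \<le> R"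
proof -
  obtain m where m: "0 < m" "\<And>x. m * (norm x)\<^sup>2 \<le> V x"
    using quadform_coercive[of P] P_pos unfolding V_def by blast
  have "norm z \<le> sqrt (\<bar>c\<bar> / m) + 1" if "V z \<le> c" for z
  proof -
    have "(norm z)\<^sup>2 \<le> \<bar>c\<bar> / m" using m(1) m(2)[of z] that by (simp add: field_simps)
    then have "norm z \<le> sqrt (\<bar>c\<bar> / m)" by (rule real_le_rsqrt)
    then show ?thesis by simp
  qed
  moreover have "0 < sqrt (\<bar>c\<bar> / m) + 1" using m by (simp add: add_nonneg_pos)
  ultimately show ?thesis using that by blast
qed

text \<open>The term \<open>K\<^sub>0 (q - x)\<close> is not homogeneous; it leaves the factor \<open>exp (\<mu> \<sigma> (\<lambda>\<^sub>i - 1))\<close>, which stays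
  bounded because \<open>\<lambda>\<^sub>i \<le> 1\<close> and \<open>\<mu> \<sigma> \<ge> 0\<close>. The second alternative for \<open>h\<close> covers the states at which
  the quantized state and the true one lie on different sides of the unit sphere; then \<open>\<sigma>\<close> is close
  to \<open>0\<close> and both feedbacks are close to \<open>K z\<close>.\<close>

lemma feedback_near:
  fixes K0 K :: "real^'n^'m" and \<kappa> \<mu> \<mu>' :: real
  assumes other: "monotone_dilation \<Gamma> P g' a' b'"
    and g: "g = (\<chi> i. 1 + \<mu> * lam $ i)" and lam: "\<And>i. lam $ i \<le> 1" and \<kappa>: "0 < \<kappa>"
  shows "\<exists>\<eta>>0. \<forall>w \<sigma> z h. (\<forall>i. \<bar>w $ i - 1\<bar> \<le> \<eta>) \<and> 1 \<le> V z \<and> V z \<le> 1 + \<eta> \<and> 0 \<le> \<mu> * \<sigma> \<and>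
     (h = hom_term K P G \<mu> (diag_apply \<Gamma> w (D \<sigma> z)) \<or>
      2 * a * \<bar>\<sigma>\<bar> \<le> \<bar>ln (V (diag_apply \<Gamma> w z))\<bar> \<and>
      h = hom_term K P (\<Gamma> ** diag_mat g' ** matrix_inv \<Gamma>) \<mu>' (diag_apply \<Gamma> w (D \<sigma> z)))
     \<longrightarrow> norm (exp (- (1 + \<mu>) * \<sigma>) *\<^sub>R (K0 *v (diag_apply \<Gamma> w (D \<sigma> z) - D \<sigma> z) + h) - K *v z) \<le> \<kappa>"
    (is "\<exists>\<eta>>0. \<forall>w \<sigma> z h. ?Q \<eta> w \<sigma> z h \<longrightarrow> ?N w \<sigma> z h \<le> \<kappa>")
proof (rule ccontr)
  interpret o: monotone_dilation \<Gamma> P g' a' b' by (rule other)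
  \<comment> \<open>Counterexamples for \<open>\<eta> = 1 / (n + 1)\<close> have weights tending to
    1 and, along a subsequence, \<open>z\<close> tending to a point \<open>l\<close> of the unit
    sphere. The levels \<open>\<sigma> n\<close> need not converge; each term is therefore brought
    to a form in which they cancel, enter a bounded factor, or tend to 0.\<close>
  assume "\<not> ?thesis"
  then have "\<forall>n. \<exists>w \<sigma> z h. ?Q (inverse (real (Suc n))) w \<sigma> z h \<and> \<kappa> < ?N w \<sigma> z h"
    by (metis inverse_positive_iff_positive not_le of_nat_0_less_iff zero_less_Suc)
  then obtain w \<sigma> z h where Q: "\<And>n. ?Q (inverse (real (Suc n))) (w n) (\<sigma> n) (z n) (h n)"
    and big: "\<And>n. \<kappa> < ?N (w n) (\<sigma> n) (z n) (h n)"
    by metis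
  define y where "y = (\<lambda>n. diag_apply \<Gamma> (w n) (z n))"
  have w: "\<And>n i. \<bar>w n $ i - 1\<bar> \<le> inverse (real (Suc n))" and V1: "\<And>n. 1 \<le> V (z n)"
    and V2: "\<And>n. V (z n) \<le> 1 + inverse (real (Suc n))" and sgn: "\<And>n. 0 \<le> \<mu> * \<sigma> n"
    and h: "\<And>n. h n = hom_term K P G \<mu> (D (\<sigma> n) (y n)) \<or>
      2 * a * \<bar>\<sigma> n\<bar> \<le> \<bar>ln (V (y n))\<bar> \<and>
      h n = hom_term K P (\<Gamma> ** diag_mat g' ** matrix_inv \<Gamma>) \<mu>' (D (\<sigma> n) (y n))"
    using Q unfolding y_def D_diag_commute by blast+
  obtain R where R: "\<And>x. V x \<le> 2 \<Longrightarrow> norm x \<le> R" using V_sublevel_bounded by blast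
  have "V (z n) \<le> 2" for n using V2[of n] by (rule order_trans) (simp add: field_simps)
  then have "bounded (range z)" using R by (auto simp: bounded_iff)
  then obtain l r where r: "strict_mono r" and zl: "(z \<circ> r) \<longlonglongrightarrow> l"
    using bounded_imp_convergent_subsequence by blast
  have inv0: "(\<lambda>n. inverse (real (Suc (r n)))) \<longlonglongrightarrow> 0"
    using LIMSEQ_subseq_LIMSEQ[OF LIMSEQ_inverse_real_of_nat r] by (simp add: o_def)
  have zr: "(\<lambda>n. z (r n)) \<longlonglongrightarrow> l" using zl by (simp add: o_def)
  have "(\<lambda>n. V (z (r n))) \<longlonglongrightarrow> 1"
  proof (rule tendsto_sandwich[OF _ _ tendsto_const])
    show "(\<lambda>n. 1 + inverse (real (Suc (r n)))) \<longlonglongrightarrow> 1"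
      using tendsto_add[OF tendsto_const[of 1] inv0] by simp
  qed (use V1 V2 in auto)
  then have Vl: "V l = 1" using LIMSEQ_unique tendsto_V[OF zr] by blast
  have wr: "(\<lambda>n. w (r n)) \<longlonglongrightarrow> 1"
  proof (rule vec_tendstoI)
    fix i
    have "(\<lambda>n. w (r n) $ i - 1) \<longlonglongrightarrow> 0"
      by (rule Lim_null_comparison[OF _ inv0], intro always_eventually allI) (simp only: real_norm_def w)
    then show "(\<lambda>n. w (r n) $ i) \<longlonglongrightarrow> 1 $ i" by (simp add: LIM_zero_iff)
  qed
  have yr: "(\<lambda>n. y (r n)) \<longlonglongrightarrow> l"
    using diag.tendsto[OF wr zr] \<Gamma> by (simp add: y_def)
  define T where "T = (\<lambda>n. exp (- (1 + \<mu>) * \<sigma> n) *\<^sub>R (K0 *v (D (\<sigma> n) (y n) - D (\<sigma> n) (z n))))"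
  \<comment> \<open>The default 0 on indices where the second alternative is impossible makes
    \<open>\<sigma>'\<close> tend to 0 on the whole subsequence. \<open>H\<close> and
    \<open>H'\<close> then both vanish in the limit, without sorting the indices by
    alternative.\<close>
  define \<sigma>' where "\<sigma>' = (\<lambda>n. if 2 * a * \<bar>\<sigma> n\<bar> \<le> \<bar>ln (V (y n))\<bar> then \<sigma> n else 0)"
  define H where "H = (\<lambda>n. hom_term K P G \<mu> (y n) - K *v z n)"
  define H' where "H' = (\<lambda>n. exp (- (1 + \<mu>) * \<sigma>' n) *\<^sub>R
    hom_term K P (\<Gamma> ** diag_mat g' ** matrix_inv \<Gamma>) \<mu>' (D (\<sigma>' n) (y n)) - K *v z n)"
  have le: "\<kappa> < norm (T n) + norm (H n) + norm (H' n)" for n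
  proof -
    define u where "u = exp (- (1 + \<mu>) * \<sigma> n) *\<^sub>R h n - K *v z n"
    have "u = H n \<or> u = H' n"
      using h[of n]
    proof (elim disjE conjE)
      assume "h n = hom_term K P G \<mu> (D (\<sigma> n) (y n))"
      then have "u = H n"
        by (simp add: u_def H_def hom_term_D mult_exp_exp ring_distribs)
      then show ?thesis ..
    qed (simp add: u_def H'_def \<sigma>'_def)
    then have "norm u \<le> norm (H n) + norm (H' n)" by (elim disjE) simp_all
    moreover have "\<kappa> < norm (T n + u)"
      using big[of n] by (simp add: T_def u_def y_def D_diag_commute scaleR_add_right add_diff_eq)
    ultimately show ?thesis using norm_triangle_ineq[of "T n" u] by linarith
  qed
  have "(\<lambda>n. K0 *v diag_apply \<Gamma> (\<chi> i. exp (\<mu> * \<sigma> (r n) * (lam $ i - 1)) * (w (r n) $ i - 1)) (z (r n)))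
      \<longlonglongrightarrow> K0 *v diag_apply \<Gamma> 0 l"
  proof (intro bounded_linear.tendsto[OF matrix_vector_mul_bounded_linear] diag.tendsto zr vec_tendstoI)
    fix i
    have "norm (exp (\<mu> * \<sigma> (r n) * (lam $ i - 1)) * (w (r n) $ i - 1)) \<le> inverse (real (Suc (r n)))" for n
    proof -
      have "\<mu> * \<sigma> (r n) * (lam $ i - 1) \<le> 0"
        using sgn[of "r n"] lam[of i] by (simp add: mult_nonneg_nonpos)
      then have "exp (\<mu> * \<sigma> (r n) * (lam $ i - 1)) * \<bar>w (r n) $ i - 1\<bar> \<le> 1 * inverse (real (Suc (r n)))"
        by (intro mult_mono w) auto
      then show ?thesis by (simp add: abs_mult)
    qed
    then show "(\<lambda>n. (\<chi> i. exp (\<mu> * \<sigma> (r n) * (lam $ i - 1)) * (w (r n) $ i - 1)) $ i) \<longlonglongrightarrow> 0 $ i"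
      by (simp add: Lim_null_comparison[OF _ inv0])
  qed
  \<comment> \<open>The exponents combine: \<open>- (1 + \<mu>) * \<sigma> + \<sigma> * (1 + \<mu> *
    lam $ i) = \<mu> * \<sigma> * (lam $ i - 1)\<close>, which is at most 0.\<close>
  moreover have "T n = K0 *v diag_apply \<Gamma> (\<chi> i. exp (\<mu> * \<sigma> n * (lam $ i - 1)) * (w n $ i - 1)) (z n)" for n
  proof -
    have "diag_apply \<Gamma> (w n) x - x = diag_apply \<Gamma> (w n - 1) x" for x
      using \<Gamma> by (simp add: diag.diff_left)
    then have "D (\<sigma> n) (y n) - D (\<sigma> n) (z n) = diag_apply \<Gamma> (w n - 1) (D (\<sigma> n) (z n))"
      by (simp add: y_def D_diag_commute)
    moreover have "exp (- (1 + \<mu>) * \<sigma> n) *\<^sub>R ((w n - 1) * (\<chi> i. exp (\<sigma> n * g $ i)))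
        = (\<chi> i. exp (\<mu> * \<sigma> n * (lam $ i - 1)) * (w n $ i - 1))"
    proof -
      have "exp (- (1 + \<mu>) * \<sigma> n) * exp (\<sigma> n * (1 + \<mu> * lam $ i)) = exp (\<mu> * \<sigma> n * (lam $ i - 1))" for i
        by (simp add: mult_exp_exp algebra_simps)
      then show ?thesis by (simp add: vec_eq_iff g mult.left_commute mult.commute)
    qed
    ultimately show ?thesis
      using \<Gamma> by (simp add: T_def D_def diag_apply_diag_apply flip: diag.scaleR_left matrix_vector_mult_scaleR)
  qed
  ultimately have T: "(\<lambda>n. T (r n)) \<longlonglongrightarrow> 0" by (simp add: diag.zero_left)
  have Kz: "(\<lambda>n. K *v z (r n)) \<longlonglongrightarrow> K *v l"
    by (rule bounded_linear.tendsto[OF matrix_vector_mul_bounded_linear zr])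
  have H: "(\<lambda>n. H (r n)) \<longlonglongrightarrow> 0"
    using tendsto_diff[OF hom_term_tendsto[OF Vl yr, of K \<mu>] Kz] by (simp add: H_def)
  have "(\<lambda>n. \<bar>ln (V (y (r n)))\<bar> / (2 * a)) \<longlonglongrightarrow> \<bar>ln (V l)\<bar> / (2 * a)"
    using Vl a_pos by (intro tendsto_intros yr) auto
  then have "(\<lambda>n. \<bar>ln (V (y (r n)))\<bar> / (2 * a)) \<longlonglongrightarrow> 0" by (simp add: Vl)
  then have \<sigma>': "(\<lambda>n. \<sigma>' (r n)) \<longlonglongrightarrow> 0"
    by (rule Lim_null_comparison[rotated]) (use a_pos in \<open>auto simp: \<sigma>'_def field_simps\<close>)
  have "(\<lambda>n. D (\<sigma>' (r n)) (y (r n))) \<longlonglongrightarrow> D 0 l" by (intro tendsto_D \<sigma>' yr)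
  then have "(\<lambda>n. D (\<sigma>' (r n)) (y (r n))) \<longlonglongrightarrow> l" by simp
  from o.hom_term_tendsto[OF Vl this, of K \<mu>']
  have "(\<lambda>n. H' (r n)) \<longlonglongrightarrow> exp (- (1 + \<mu>) * 0) *\<^sub>R (K *v l) - K *v l"
    unfolding H'_def by (intro tendsto_intros \<sigma>' Kz)
  then have H': "(\<lambda>n. H' (r n)) \<longlonglongrightarrow> 0" by simp
  have "(\<lambda>n. norm (T (r n)) + norm (H (r n)) + norm (H' (r n))) \<longlonglongrightarrow> 0"
    using tendsto_add[OF tendsto_add[OF tendsto_norm[OF T] tendsto_norm[OF H]] tendsto_norm[OF H']] by simp
  then have "\<kappa> \<le> 0"
    by (rule LIMSEQ_le_const) (use le less_imp_le in blast)
  then show False using \<kappa> by simp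
qed

text \<open>Quantizer and switch enter only through weights \<open>w\<close> near 1 and a choice
  \<open>h\<close> between two homogeneous terms, so one statement serves both stages.
  \<open>F\<close> is the condition under which the foreign branch is active. After rescaling, the
  deviation of the field from \<open>M *v z\<close> lies in the range of \<open>B\<close> and is
  bounded by \<open>feedback_near\<close>.\<close>

lemma homogeneous_stage_exists:
  fixes A0 :: "real^'n^'n" and B :: "real^'m^'n" and K0 K :: "real^'n^'m"
  assumes other: "monotone_dilation \<Gamma> P g' a' b'"
    and g: "g = (\<chi> i. 1 + \<mu> * lam $ i)" and lam: "\<And>i. lam $ i \<le> 1"
    and A0_D: "\<And>s x. A0 *v D s x = exp (\<mu> * s) *\<^sub>R D s (A0 *v x)"
    and B_D: "\<And>s u. D s (B *v u) = exp s *\<^sub>R (B *v u)"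
    and decr: "\<And>x. x \<noteq> 0 \<Longrightarrow> x \<bullet> (P *v ((A0 + B ** K) *v x)) < 0"
    and S: "S = {0..} \<and> 0 \<le> \<mu> \<and> F = (\<lambda>v. v < 1) \<or> S = {..0} \<and> \<mu> \<le> 0 \<and> F = (\<lambda>v. 1 \<le> v)"
  shows "\<exists>\<eta>>0. \<exists>\<kappa>>0. \<exists>\<rho>>0. \<exists>\<delta>0>0. \<forall>f w h. (\<forall>x i. \<bar>w x $ i - 1\<bar> \<le> \<delta>0) \<and>
     (\<forall>x. f x = A0 *v x + B *v (K0 *v (diag_apply \<Gamma> (w x) x - x) + h x)) \<and>
     (\<forall>x. h x = hom_term K P G \<mu> (diag_apply \<Gamma> (w x) x) \<or>
        F (V (diag_apply \<Gamma> (w x) x)) \<and>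
        h x = hom_term K P (\<Gamma> ** diag_mat g' ** matrix_inv \<Gamma>) \<mu>' (diag_apply \<Gamma> (w x) x))
     \<longrightarrow> homogeneous_stage \<Gamma> P g a b f (A0 + B ** K) \<mu> \<eta> \<kappa> \<rho> S"
proof -
  define M where "M = A0 + B ** K"
  have minus: "(- (P ** M)) *v x = - (P *v (M *v x))" for x
    using matrix_vector_mult_diff_rdistrib[of 0 "P ** M" x] by (simp add: matrix_vector_mul_assoc)
  have "0 < x \<bullet> ((- (P ** M)) *v x)" if "x \<noteq> 0" for x
    using decr[OF that]
    by (simp add: minus) (simp add: M_def)
  then obtain c where c: "0 < c" "\<And>x. c * (x \<bullet> (P *v x)) \<le> x \<bullet> ((- (P ** M)) *v x)"
    using quadform_compare[of P "- (P ** M)"] P_pos by blast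
  obtain R where R: "0 < R" "\<And>x. V x \<le> 2 \<Longrightarrow> norm x \<le> R" using V_sublevel_bounded by blast
  obtain CP where CP: "0 < CP" "\<And>x y. norm (x \<bullet> (P *v y)) \<le> norm x * norm y * CP"
    using quad.pos_bounded by blast
  obtain CB where CB: "0 < CB" "\<And>u. norm (B *v u) \<le> norm u * CB"
    using bounded_linear.pos_bounded[OF matrix_vector_mul_bounded_linear[of B]] by blast
  \<comment> \<open>On the shell the unperturbed form is at most \<open>- c\<close>. An error
    \<open>2 * \<kappa>\<close> adds at most \<open>R * (2 * \<kappa>) * CP = c / 2\<close>, which
    leaves the decrease \<open>\<rho> = c / 2\<close>.\<close>
  define \<kappa> where "\<kappa> = c / (4 * CP * R)"
  have \<kappa>: "0 < \<kappa>" using c CP R by (simp add: \<kappa>_def)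
  have "0 < \<kappa> / CB" using \<kappa> CB by simp
  from feedback_near[OF other g lam this, of K \<mu>' K0]
  obtain \<eta>0 where \<eta>0: "0 < \<eta>0" and near: "\<And>w \<sigma> z h. \<lbrakk>\<forall>i. \<bar>w $ i - 1\<bar> \<le> \<eta>0; 1 \<le> V z; V z \<le> 1 + \<eta>0; 0 \<le> \<mu> * \<sigma>;
     h = hom_term K P G \<mu> (diag_apply \<Gamma> w (D \<sigma> z)) \<or>
      2 * a * \<bar>\<sigma>\<bar> \<le> \<bar>ln (V (diag_apply \<Gamma> w z))\<bar> \<and>
      h = hom_term K P (\<Gamma> ** diag_mat g' ** matrix_inv \<Gamma>) \<mu>' (diag_apply \<Gamma> w (D \<sigma> z))\<rbrakk>
     \<Longrightarrow> norm (exp (- (1 + \<mu>) * \<sigma>) *\<^sub>R (K0 *v (diag_apply \<Gamma> w (D \<sigma> z) - D \<sigma> z) + h) - K *v z) \<le> \<kappa> / CB"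
    by blast
  define \<eta> where "\<eta> = min 1 \<eta>0"
  have \<eta>: "0 < \<eta>" "\<eta> \<le> 1" "\<eta> \<le> \<eta>0" using \<eta>0 by (auto simp: \<eta>_def)
  \<comment> \<open>The bound \<open>1 / 2\<close> keeps the weights away from 0, so the weighted
    \<open>z\<close> below is nonzero and has a logarithm.\<close>
  define \<delta>0 where "\<delta>0 = min (1 / 2) \<eta>0"
  have \<delta>0: "0 < \<delta>0" "\<delta>0 < 1" "\<delta>0 \<le> \<eta>0" using \<eta>0 by (auto simp: \<delta>0_def)
  show ?thesis
  proof (intro exI conjI allI impI)
    show "0 < \<eta>" "0 < \<kappa>" "0 < c / 2" "0 < \<delta>0" using \<eta> \<kappa> c \<delta>0 by simp_all
    fix f :: "real^'n \<Rightarrow> real^'n" and w h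
    assume asm: "(\<forall>x i. \<bar>w x $ i - 1\<bar> \<le> \<delta>0) \<and>
     (\<forall>x. f x = A0 *v x + B *v (K0 *v (diag_apply \<Gamma> (w x) x - x) + h x)) \<and>
     (\<forall>x. h x = hom_term K P G \<mu> (diag_apply \<Gamma> (w x) x) \<or>
        F (V (diag_apply \<Gamma> (w x) x)) \<and>
        h x = hom_term K P (\<Gamma> ** diag_mat g' ** matrix_inv \<Gamma>) \<mu>' (diag_apply \<Gamma> (w x) x))"
    from asm have w_near: "\<And>x i. \<bar>w x $ i - 1\<bar> \<le> \<delta>0"
      and f_eq: "\<And>x. f x = A0 *v x + B *v (K0 *v (diag_apply \<Gamma> (w x) x - x) + h x)"
      and h_cases: "\<And>x. h x = hom_term K P G \<mu> (diag_apply \<Gamma> (w x) x) \<or>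
        F (V (diag_apply \<Gamma> (w x) x)) \<and>
        h x = hom_term K P (\<Gamma> ** diag_mat g' ** matrix_inv \<Gamma>) \<mu>' (diag_apply \<Gamma> (w x) x)"
      by blast+
    show "homogeneous_stage \<Gamma> P g a b f (A0 + B ** K) \<mu> \<eta> \<kappa> (c / 2) S"
      unfolding M_def[symmetric]
    proof
      show "0 < \<eta>" "0 < \<kappa>" "0 < c / 2" using \<eta> \<kappa> c by simp_all
      fix z w' :: "real^'n" assume z: "1 \<le> V z" "V z \<le> 1 + \<eta>"
      have zR: "norm z \<le> R" using z \<eta> by (intro R) simp
      {
        assume w': "norm (w' - M *v z) \<le> 2 * \<kappa>"
        have "z \<bullet> (P *v w') = z \<bullet> (P *v (M *v z)) + z \<bullet> (P *v (w' - M *v z))"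
          by (simp add: quad.diff_right)
        also have "z \<bullet> (P *v (M *v z)) \<le> - c"
        proof -
          have "z \<bullet> (P *v (M *v z)) \<le> - (c * V z)"
            using c(2)[of z] by (simp add: V_def minus)
          also have "\<dots> \<le> - c" using z c by simp
          finally show ?thesis .
        qed
        also have "z \<bullet> (P *v (w' - M *v z)) \<le> norm z * norm (w' - M *v z) * CP"
          using CP(2)[of z "w' - M *v z"] by (simp add: abs_le_iff)
        also have "\<dots> \<le> R * (2 * \<kappa>) * CP"
          using zR w' R CP by (intro mult_right_mono mult_mono) auto
        also have "\<dots> = c / 2" using R CP by (simp add: \<kappa>_def)
        finally show "z \<bullet> (P *v w') \<le> - (c / 2)" by simp
      }
      fix \<sigma> assume \<sigma>: "\<sigma> \<in> S"
      define x where "x = D \<sigma> z"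
      define y where "y = diag_apply \<Gamma> (w x) z"
      define k where "k = K0 *v (diag_apply \<Gamma> (w x) x - x) + h x"
      define u where "u = exp (- (1 + \<mu>) * \<sigma>) *\<^sub>R k"
      have sgn: "0 \<le> \<mu> * \<sigma>" using S \<sigma> by (auto intro: mult_nonneg_nonneg mult_nonpos_nonpos)
      \<comment> \<open>With the foreign branch active, \<open>V (D \<sigma> y)\<close> is on the
        wrong side of 1 for the sign of \<open>\<sigma>\<close>. The growth bounds then confine
        \<open>\<sigma>\<close> by \<open>\<bar>ln (V y)\<bar>\<close>, a small quantity as
        \<open>y\<close> is near the sphere.\<close>
      have small: "2 * a * \<bar>\<sigma>\<bar> \<le> \<bar>ln (V y)\<bar>" if F: "F (V (diag_apply \<Gamma> (w x) x))"
      proof -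
        have "w x $ i \<noteq> 0" for i using w_near[of x i] \<delta>0 by auto
        then have "(\<chi> i. inverse (w x $ i)) * w x = 1" by (simp add: vec_eq_iff)
        then have "diag_apply \<Gamma> (\<chi> i. inverse (w x $ i)) y = z"
          using \<Gamma> by (simp add: y_def diag_apply_diag_apply)
        moreover have "z \<noteq> 0" using z by auto
        ultimately have y0: "y \<noteq> 0" by (auto simp: diag.zero_right)
        then have Vy: "0 < V y" by (rule V_pos)
        have F': "F (V (D \<sigma> y))" using F by (simp add: x_def y_def D_diag_commute)
        from S show ?thesis
        proof (elim disjE conjE)
          assume *: "S = {0..}" "F = (\<lambda>v. v < 1)"
          then have "exp (2 * a * \<sigma>) * V y < 1"
            using V_D_lower[of \<sigma> y] \<sigma> F' by simp
          then have "ln (exp (2 * a * \<sigma>) * V y) < 0" using Vy by simp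
          then have "2 * a * \<sigma> < - ln (V y)" using Vy y0 by (simp add: ln_mult)
          then show ?thesis using \<sigma> * by simp
        next
          assume *: "S = {..0}" "F = (\<lambda>v. 1 \<le> v)"
          then have "1 \<le> exp (2 * a * \<sigma>) * V y"
            using V_D_neg(2)[of \<sigma> y] \<sigma> F' by simp
          then have "0 \<le> ln (exp (2 * a * \<sigma>) * V y)" by simp
          then have "- (2 * a * \<sigma>) \<le> ln (V y)" using Vy y0 by (simp add: ln_mult)
          then show ?thesis using \<sigma> * by simp
        qed
      qed
      have "norm (u - K *v z) \<le> \<kappa> / CB"
        unfolding u_def k_def x_def
      proof (rule near)
        show "\<forall>i. \<bar>w (D \<sigma> z) $ i - 1\<bar> \<le> \<eta>0" using w_near \<delta>0(3) order_trans by blast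
        show "1 \<le> V z" "V z \<le> 1 + \<eta>0" "0 \<le> \<mu> * \<sigma>" using z \<eta> sgn by auto
      qed (use h_cases[of x] small in \<open>unfold y_def x_def, blast\<close>)
      then have "norm (B *v (u - K *v z)) \<le> \<kappa>"
        using CB order_trans[OF CB(2)[of "u - K *v z"]] by (simp add: field_simps)
      moreover have "exp (- \<mu> * \<sigma>) *\<^sub>R D (- \<sigma>) (f (D \<sigma> z)) - M *v z = B *v (u - K *v z)"
      proof -
        have "D (- \<sigma>) (A0 *v x) = exp (\<mu> * \<sigma>) *\<^sub>R (A0 *v z)"
          by (simp add: x_def A0_D linear_cmul[OF linear_D])
        with f_eq[of x] have "D (- \<sigma>) (f x) = exp (\<mu> * \<sigma>) *\<^sub>R (A0 *v z)
            + exp (- \<sigma>) *\<^sub>R (B *v k)"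
          by (simp add: linear_add[OF linear_D] B_D k_def)
        then have "exp (- \<mu> * \<sigma>) *\<^sub>R D (- \<sigma>) (f x) = A0 *v z + B *v u"
          by (simp add: scaleR_add_right mult_exp_exp u_def matrix_vector_mult_scaleR ring_distribs
              add.commute)
        then show ?thesis
          by (simp add: x_def M_def matrix_vector_mult_add_rdistrib matrix_vector_mul_assoc
              matrix_vector_mult_diff_distrib)
      qed
      ultimately show "norm (exp (- \<mu> * \<sigma>) *\<^sub>R D (- \<sigma>) (f (D \<sigma> z)) - M *v z) \<le> \<kappa>" by simp
    qed
  qed
qed

end

section \<open>Descent and settling\<close>

context homogeneous_stage
begin

text \<open>With this constant, \<open>\<sigma>' = - rate * exp (\<mu> * \<sigma>)\<close> meets the
  condition \<open>slow\<close> with equality.\<close>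

definition rate :: real where "rate = \<rho> / (b * (1 + \<eta>))"

lemma rate: "0 < rate" "rate * (b * (1 + \<eta>)) = \<rho>"
  using \<rho> \<eta> a_pos a_le_b by (auto simp: rate_def)

text \<open>For \<open>\<mu> = 0\<close> the extremal barrier falls at constant speed, so the time
  is proportional to the drop of the level.\<close>

lemma descent_linear:
  assumes sol: "filippov_solution f x0 x" and \<mu>: "\<mu> = 0" and t: "0 \<le> t0" and \<sigma>: "\<sigma>1 \<le> \<sigma>0" "{\<sigma>1..\<sigma>0} \<subseteq> S"
    and init: "V (D (- \<sigma>0) (x t0)) \<le> 1"
  shows "V (D (- \<sigma>1) (x (t0 + (\<sigma>0 - \<sigma>1) / rate))) \<le> 1"
proof -
  define \<sigma> where "\<sigma> = (\<lambda>t. \<sigma>0 - rate * (t - t0))"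
  define t1 where "t1 = t0 + (\<sigma>0 - \<sigma>1) / rate"
  have t1: "t0 \<le> t1" "\<sigma> t1 = \<sigma>1" using \<sigma> rate by (auto simp: t1_def \<sigma>_def)
  have "V (D (- \<sigma> t1) (x t1)) \<le> 1"
  proof (rule sublevel_invariant[OF sol t t1(1), where \<sigma>' = "\<lambda>_. - rate"])
    fix s assume s: "s \<in> {t0..t1}"
    show "(\<sigma> has_real_derivative - rate) (at s)"
      unfolding \<sigma>_def by (auto intro!: derivative_eq_intros)
    have "rate * (s - t0) \<le> rate * (t1 - t0)" using s rate by (intro mult_left_mono) auto
    then have "\<sigma>1 \<le> \<sigma> s" using t1(2) unfolding \<sigma>_def by linarith
    moreover have "\<sigma> s \<le> \<sigma>0" using s rate by (simp add: \<sigma>_def)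
    ultimately have "\<sigma> s \<in> {\<sigma>1..\<sigma>0}" by simp
    then show "\<sigma> s \<in> S" using \<sigma> by blast
    show "- (- rate) * (b * (1 + \<eta>)) \<le> \<rho> * exp (\<mu> * \<sigma> s)" using rate \<mu> by simp
  qed (use init t1 in \<open>auto simp: \<sigma>_def\<close>)
  then show ?thesis using t1 by (simp add: t1_def)
qed

text \<open>The barrier is the solution of \<open>\<sigma>' = - rate * exp (\<mu> \<sigma>)\<close>, for which \<open>exp (- \<mu> \<sigma>)\<close> is affine.\<close>

lemma descent:
  assumes sol: "filippov_solution f x0 x" and \<mu>: "\<mu> \<noteq> 0" and t: "0 \<le> t0" and \<sigma>: "\<sigma>1 \<le> \<sigma>0" "{\<sigma>1..\<sigma>0} \<subseteq> S"
    and init: "V (D (- \<sigma>0) (x t0)) \<le> 1"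
    and t1: "t1 = t0 + (exp (- \<mu> * \<sigma>1) - exp (- \<mu> * \<sigma>0)) / (rate * \<mu>)"
  shows "t0 \<le> t1" "V (D (- \<sigma>1) (x t1)) \<le> 1"
proof -
  define E where "E = (\<lambda>t. exp (- \<mu> * \<sigma>0) + rate * \<mu> * (t - t0))"
  define \<sigma> where "\<sigma> = (\<lambda>t. - ln (E t) / \<mu>)"
  have E1: "E t1 = exp (- \<mu> * \<sigma>1)" using \<mu> rate by (simp add: E_def t1)
  have E0: "E t0 = exp (- \<mu> * \<sigma>0)" by (simp add: E_def)
  show le: "t0 \<le> t1"
  proof (cases "0 < \<mu>")
    case True
    then have "exp (- \<mu> * \<sigma>0) \<le> exp (- \<mu> * \<sigma>1)" using \<sigma> by simp
    then show ?thesis using True rate by (simp add: t1)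
  next
    case False
    then have "exp (- \<mu> * \<sigma>1) \<le> exp (- \<mu> * \<sigma>0)" using \<sigma> by (simp add: mult_left_mono_neg)
    then show ?thesis using False \<mu> rate by (simp add: t1 divide_nonpos_nonpos mult_nonneg_nonpos)
  qed
  \<comment> \<open>\<open>E\<close> is affine, rising or falling with the sign of
    \<open>\<mu>\<close>. It stays between its positive end values, so the logarithm is legitimate
    and \<open>\<sigma>\<close> stays between \<open>\<sigma>1\<close> and
    \<open>\<sigma>0\<close>.\<close>
  have E: "0 < E s \<and> \<sigma>1 \<le> \<sigma> s \<and> \<sigma> s \<le> \<sigma>0" if s: "s \<in> {t0..t1}" for s
  proof (cases "0 < \<mu>")
    case True
    then have "0 < rate * \<mu>" using rate(1) by simp
    then have "rate * \<mu> * (t0 - t0) \<le> rate * \<mu> * (s - t0)" "rate * \<mu> * (s - t0) \<le> rate * \<mu> * (t1 - t0)"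
      using s by (intro mult_left_mono; simp)+
    then have e: "exp (- \<mu> * \<sigma>0) \<le> E s" "E s \<le> exp (- \<mu> * \<sigma>1)"
      unfolding E0[symmetric] E1[symmetric] by (simp_all only: E_def add_left_mono)
    then have pos: "0 < E s" using exp_gt_zero less_le_trans by blast
    then have "- \<mu> * \<sigma>0 \<le> ln (E s)" "ln (E s) \<le> - \<mu> * \<sigma>1"
      using e pos ln_le_cancel_iff[of "exp (- \<mu> * \<sigma>0)" "E s"] ln_le_cancel_iff[of "E s" "exp (- \<mu> * \<sigma>1)"]
      by simp_all
    then show ?thesis using True pos by (simp add: \<sigma>_def field_simps)
  next
    case False
    then have \<mu>neg: "\<mu> < 0" using \<mu> by simp
    then have "rate * \<mu> < 0" using rate(1) by (simp add: mult_pos_neg)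
    then have "rate * \<mu> * (s - t0) \<le> rate * \<mu> * (t0 - t0)" "rate * \<mu> * (t1 - t0) \<le> rate * \<mu> * (s - t0)"
      using s by (intro mult_left_mono_neg; simp)+
    then have e: "E s \<le> exp (- \<mu> * \<sigma>0)" "exp (- \<mu> * \<sigma>1) \<le> E s"
      unfolding E0[symmetric] E1[symmetric] by (simp_all only: E_def add_left_mono)
    then have pos: "0 < E s" using exp_gt_zero less_le_trans by blast
    then have "ln (E s) \<le> - \<mu> * \<sigma>0" "- \<mu> * \<sigma>1 \<le> ln (E s)"
      using e pos ln_le_cancel_iff[of "E s" "exp (- \<mu> * \<sigma>0)"] ln_le_cancel_iff[of "exp (- \<mu> * \<sigma>1)" "E s"]
      by simp_all
    then show ?thesis using \<mu>neg pos by (simp add: \<sigma>_def field_simps)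
  qed
  have exp\<sigma>: "exp (\<mu> * \<sigma> s) = 1 / E s" if "s \<in> {t0..t1}" for s
  proof -
    have "\<mu> * \<sigma> s = - ln (E s)" using \<mu> by (simp add: \<sigma>_def)
    then show ?thesis using E[OF that] by (simp add: exp_minus divide_inverse)
  qed
  have "V (D (- \<sigma> t1) (x t1)) \<le> 1"
  proof (rule sublevel_invariant[OF sol t le, where \<sigma>' = "\<lambda>s. - rate / E s"])
    show "continuous_on {t0..t1} (\<lambda>s. - rate / E s)"
      using E unfolding E_def by (intro continuous_intros) (auto simp: less_imp_neq[symmetric])
    show "V (D (- \<sigma> t0) (x t0)) \<le> 1" using init \<mu> by (simp add: \<sigma>_def E0)
    fix s assume s: "s \<in> {t0..t1}"
    show "(\<sigma> has_real_derivative - rate / E s) (at s)"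
      unfolding \<sigma>_def using E[OF s] \<mu>
      by (auto intro!: derivative_eq_intros simp: E_def divide_simps)
    show "\<sigma> s \<in> S" using E[OF s] \<sigma> by auto
    show "- (- rate / E s) * (b * (1 + \<eta>)) \<le> \<rho> * exp (\<mu> * \<sigma> s)"
      unfolding exp\<sigma>[OF s] using rate(2) by simp
  qed (use le in simp)
  then show "V (D (- \<sigma>1) (x t1)) \<le> 1" using \<mu> by (simp add: \<sigma>_def E1)
qed

text \<open>For \<open>\<mu> < 0\<close> the descent times from level 0 to all
  \<open>\<sigma> \<le> 0\<close> share the bound \<open>- 1 / (rate * \<mu>)\<close>. Each level
  has its own barrier, and a constant barrier then holds it until \<open>t\<close>.\<close>

lemma settles:
  assumes sol: "filippov_solution f x0 x" and S: "S = {..0}" and \<mu>: "\<mu> < 0"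
    and t0: "0 \<le> t0" and init: "V (x t0) \<le> 1" and t: "t0 - 1 / (rate * \<mu>) \<le> t"
  shows "x t = 0"
proof (rule eq_0_if_V_sublevels)
  fix \<sigma> :: real assume \<sigma>: "\<sigma> \<le> 0"
  define t1 where "t1 = t0 + (exp (- \<mu> * \<sigma>) - exp (- \<mu> * 0)) / (rate * \<mu>)"
  have t1: "t0 \<le> t1" "V (D (- \<sigma>) (x t1)) \<le> 1"
    using descent[OF sol _ t0 \<sigma> _ _ t1_def] \<mu> S init by auto
  have "t1 \<le> t0 - 1 / (rate * \<mu>)"
  proof -
    have "exp (- \<mu> * \<sigma>) / (rate * \<mu>) \<le> 0"
      using rate \<mu> by (simp add: divide_nonneg_nonpos mult_nonneg_nonpos)
    then show ?thesis by (simp add: t1_def diff_divide_distrib)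
  qed
  then have "t1 \<le> t" using t by linarith
  then show "V (D (- \<sigma>) (x t)) \<le> 1"
    by (rule sublevel_invariant_const[OF sol _ _ _ t1(2), rotated]) (use t0 t1(1) \<sigma> S in auto)
qed

end

lemma class_K_powr_add:
  assumes "0 < p" "0 < q"
  shows "class_K (\<lambda>r. r powr p + r powr q)"
  unfolding class_K_def
proof (intro conjI)
  show "continuous_on {0..} (\<lambda>r. r powr p + r powr q :: real)"
    using assms by (intro continuous_on_add continuous_on_powr' continuous_intros) auto
  show "strict_mono_on {0..} (\<lambda>r. r powr p + r powr q :: real)"
    using assms by (intro strict_mono_onI add_strict_mono powr_less_mono2) auto
qed auto

locale two_stages =
  s1: homogeneous_stage \<Gamma> P g a b f M \<mu> \<eta> \<kappa> \<rho> "{0..}" +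
  s2: homogeneous_stage \<Gamma> P g' a' b' f M \<mu>' \<eta>' \<kappa>' \<rho>' "{..0}"
  for \<Gamma> P :: "real^'n^'n" and g a b f M \<mu> \<eta> \<kappa> \<rho> g' a' b' \<mu>' \<eta>' \<kappa>' \<rho>'
begin

text \<open>A constant barrier through a level that captures \<open>x0\<close>. Inside the unit ball
  the level is chosen with \<open>b'\<close> and the norm read off with \<open>a'\<close>; outside,
  with \<open>a\<close> and \<open>b\<close>. This gives the two exponents, and the sum covers both
  cases.\<close>

lemma lyapunov_bound:
  assumes sol: "filippov_solution f x0 x" and t: "0 \<le> t"
  shows "wnorm P (x t) \<le> wnorm P x0 powr (a' / b') + wnorm P x0 powr (b / a)"
proof -
  have x0: "x 0 = x0" using sol by (simp add: filippov_solution_def)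
  have b': "0 < b'" using s2.a_pos s2.a_le_b by simp
  have "x0 = 0 \<or> (x0 \<noteq> 0 \<and> s1.V x0 \<le> 1) \<or> 1 < s1.V x0" by auto
  then consider "x0 = 0" | "x0 \<noteq> 0" "s1.V x0 \<le> 1" | "1 < s1.V x0" by blast
  then show ?thesis
  proof cases
    case 1
    have "x t = 0"
      by (rule s2.eq_0_if_V_sublevels, rule s2.sublevel_invariant_const[OF sol, of 0]) (use x0 1 t in auto)
    then show ?thesis by (simp add: wnorm_def)
  next
    case 2
    have V: "0 < s1.V x0" using 2 by (intro s1.V_pos)
    define \<sigma> where "\<sigma> = ln (s1.V x0) / (2 * b')"
    have \<sigma>: "\<sigma> \<le> 0" using 2 V b' by (simp add: \<sigma>_def divide_nonpos_pos)
    have "s1.V (s2.D (- \<sigma>) x0) \<le> exp (2 * b' * (- \<sigma>)) * s1.V x0"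
      using \<sigma> by (intro s2.V_D_upper) simp
    also have "\<dots> = 1" using V b' 2 by (simp add: \<sigma>_def exp_minus)
    finally have "s1.V (s2.D (- \<sigma>) (x 0)) \<le> 1" by (simp add: x0)
    then have "s1.V (s2.D (- \<sigma>) (x t)) \<le> 1"
      by (rule s2.sublevel_invariant_const[OF sol order_refl t, rotated]) (use \<sigma> in simp)
    then have "s1.V (x t) \<le> exp (2 * a' * \<sigma>)" by (rule s2.V_sublevel_neg[OF \<sigma>])
    also have "\<dots> = s1.V x0 powr (a' / b')" using V b' 2 by (simp add: powr_def \<sigma>_def)
    finally have "wnorm P (x t) \<le> sqrt (s1.V x0 powr (a' / b'))" by (simp add: s1.wnorm_V)
    also have "\<dots> = wnorm P x0 powr (a' / b')"
      using V by (simp add: s1.wnorm_V powr_powr mult.commute flip: powr_half_sqrt)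
    finally show ?thesis by (rule order_trans) simp
  next
    case 3
    define \<sigma> where "\<sigma> = ln (s1.V x0) / (2 * a)"
    have \<sigma>: "0 \<le> \<sigma>" using 3 s1.a_pos by (simp add: \<sigma>_def)
    have "x0 \<noteq> 0" using 3 by auto
    have "s1.V (s1.D (- \<sigma>) x0) \<le> exp (2 * a * (- \<sigma>)) * s1.V x0"
      using \<sigma> by (intro s1.V_D_neg) simp
    also have "\<dots> = 1" using 3 s1.a_pos \<open>x0 \<noteq> 0\<close> by (simp add: \<sigma>_def exp_minus)
    finally have "s1.V (s1.D (- \<sigma>) (x 0)) \<le> 1" by (simp add: x0)
    then have "s1.V (s1.D (- \<sigma>) (x t)) \<le> 1"
      by (rule s1.sublevel_invariant_const[OF sol order_refl t, rotated]) (use \<sigma> in simp)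
    then have "s1.V (x t) \<le> exp (2 * b * \<sigma>)" by (rule s1.V_sublevel_pos[OF \<sigma>])
    also have "\<dots> = s1.V x0 powr (b / a)" using 3 s1.a_pos \<open>x0 \<noteq> 0\<close> by (simp add: powr_def \<sigma>_def)
    finally have "wnorm P (x t) \<le> sqrt (s1.V x0 powr (b / a))" by (simp add: s1.wnorm_V)
    also have "\<dots> = wnorm P x0 powr (b / a)"
      using 3 by (simp add: s1.wnorm_V powr_powr mult.commute flip: powr_half_sqrt)
    finally show ?thesis by (rule order_trans) simp
  qed
qed

lemma lyapunov: "lyapunov_stable (wnorm P) f"
  unfolding lyapunov_stable_def
proof (intro exI conjI allI impI)
  show "class_K (\<lambda>r. r powr (a' / b') + r powr (b / a))"
    using s1.a_pos s1.a_le_b s2.a_pos s2.a_le_b by (intro class_K_powr_add) auto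
qed (rule lyapunov_bound)

text \<open>\<open>r \<le> exp r\<close> makes \<open>r / a\<close> a sufficient level. Unlike
  \<open>ln r / a\<close> it is nonnegative and continuous at the origin, as the settling-time
  function requires.\<close>

lemma entry_level:
  "s1.V (s1.D (- (wnorm P x0 / a)) x0) \<le> 1"
proof -
  define r where "r = wnorm P x0"
  have r: "0 \<le> r" "s1.V x0 = r\<^sup>2" using s1.V_nonneg[of x0] by (auto simp: r_def s1.wnorm_V)
  have "s1.V (s1.D (- (r / a)) x0) \<le> exp (2 * a * (- (r / a))) * s1.V x0"
    using r s1.a_pos by (intro s1.V_D_neg) simp
  also have "\<dots> = (r / exp r)\<^sup>2"
  proof -
    have "2 * a * (- (r / a)) = - r + - r" using s1.a_pos by (simp add: field_simps)
    then show ?thesis by (simp only: exp_add r) (simp add: exp_minus power2_eq_square divide_inverse)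
  qed
  also have "\<dots> \<le> 1"
  proof -
    have "r \<le> exp r" using exp_ge_add_one_self[of r] by linarith
    then show ?thesis using r by (intro power_le_one) (auto simp: divide_simps)
  qed
  finally show ?thesis by (simp add: r_def)
qed

lemma settled:
  assumes sol: "filippov_solution f x0 x" and \<mu>': "\<mu>' < 0"
    and T: "0 \<le> T" "s1.V (x T) \<le> 1" and t: "T - 1 / (s2.rate * \<mu>') \<le> t"
  shows "wnorm P (x t) = 0"
  using s2.settles[OF sol _ \<mu>' T t] by (simp add: s1.wnorm_V)

text \<open>The first summand is the time from the entry level to level 0 at constant speed, the
  second the bound of \<open>settles\<close>. Continuity in \<open>x0\<close> gives local
  boundedness.\<close>

lemma settling_time_finite:
  assumes \<mu>: "\<mu> = 0" and \<mu>': "\<mu>' < 0"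
  shows "settling_time (wnorm P) f (\<lambda>x0. wnorm P x0 / a / s1.rate - 1 / (s2.rate * \<mu>'))"
    (is "settling_time _ _ ?T")
  unfolding settling_time_def
proof (intro conjI allI impI)
  have pos: "1 / (s2.rate * \<mu>') \<le> 0"
    using mult_pos_neg[OF s2.rate(1) \<mu>'] by (simp only: divide_le_0_iff) simp
  have w: "0 \<le> wnorm P x0 / a / s1.rate" for x0
    using s1.rate s1.a_pos s1.V_nonneg[of x0] by (simp add: s1.wnorm_V)
  show "0 \<le> ?T x0" for x0 using w[of x0] pos by linarith
  have cont: "continuous_on (cball x0 1) ?T" for x0
    unfolding wnorm_def
    by (intro continuous_intros bounded_linear.continuous_on[OF matrix_vector_mul_bounded_linear])
       (use s1.rate s1.a_pos in auto)
  show "locally_bounded ?T"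
    unfolding locally_bounded_def
  proof
    fix x0
    have "bounded (?T ` cball x0 1)"
      using cont by (intro compact_imp_bounded compact_continuous_image) auto
    then have "bounded (?T ` ball x0 1)" by (rule bounded_subset) auto
    then show "\<exists>U. open U \<and> x0 \<in> U \<and> bounded (?T ` U)" by (intro exI[of _ "ball x0 1"]) auto
  qed
  fix x0 x t assume sol: "filippov_solution f x0 x" and t: "?T x0 \<le> t"
  have x0: "x 0 = x0" using sol by (simp add: filippov_solution_def)
  have "s1.V (s1.D (- 0) (x (0 + (wnorm P x0 / a - 0) / s1.rate))) \<le> 1"
    using s1.V_nonneg[of x0] s1.a_pos entry_level x0
    by (intro s1.descent_linear[OF sol \<mu>]) (auto simp: s1.wnorm_V)
  then show "wnorm P (x t) = 0"
    using t w by (intro settled[OF sol \<mu>' w[of x0]]) auto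
qed

text \<open>For \<open>\<mu> > 0\<close> the numerator \<open>1 - exp (- \<mu> * \<sigma>)\<close>
  of the descent time is at most 1 whatever the entry level. A constant barrier holds the unit ball
  from that time to the uniform one.\<close>

lemma settling_time_fixed:
  assumes \<mu>: "0 < \<mu>" and \<mu>': "\<mu>' < 0"
  shows "settling_time (wnorm P) f (\<lambda>x0. 1 / (s1.rate * \<mu>) - 1 / (s2.rate * \<mu>'))" (is "settling_time _ _ (\<lambda>_. ?T)")
    and "0 \<le> 1 / (s1.rate * \<mu>) - 1 / (s2.rate * \<mu>')"
proof -
  have pos: "1 / (s2.rate * \<mu>') \<le> 0"
    using mult_pos_neg[OF s2.rate(1) \<mu>'] by (simp only: divide_le_0_iff) simp
  have w: "0 \<le> 1 / (s1.rate * \<mu>)" using s1.rate \<mu> by simp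
  show T: "0 \<le> ?T" using pos w by linarith
  show "settling_time (wnorm P) f (\<lambda>_. ?T)"
    unfolding settling_time_def
  proof (intro conjI allI impI T)
    show "locally_bounded (\<lambda>x::real^'n. ?T)"
      unfolding locally_bounded_def by (intro allI exI[of _ UNIV]) (auto simp: image_constant_conv)
    fix x0 x t assume sol: "filippov_solution f x0 x" and t: "?T \<le> t"
    have x0: "x 0 = x0" using sol by (simp add: filippov_solution_def)
    define \<sigma> where "\<sigma> = wnorm P x0 / a"
    have \<sigma>: "0 \<le> \<sigma>" using s1.V_nonneg[of x0] s1.a_pos by (simp add: \<sigma>_def s1.wnorm_V)
    define t1 where "t1 = 0 + (exp (- \<mu> * 0) - exp (- \<mu> * \<sigma>)) / (s1.rate * \<mu>)"
    have t1: "0 \<le> t1" "s1.V (s1.D (- 0) (x t1)) \<le> 1"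
      using s1.descent[OF sol _ order_refl \<sigma> _ _ t1_def] \<mu> entry_level[of x0] x0 by (auto simp: \<sigma>_def)
    have "t1 \<le> 1 / (s1.rate * \<mu>)"
      unfolding t1_def using s1.rate \<mu> by (simp add: divide_right_mono)
    then have "s1.V (s1.D (- 0) (x (1 / (s1.rate * \<mu>)))) \<le> 1"
      by (rule s1.sublevel_invariant_const[OF sol t1(1) _ _ t1(2)]) simp
    then show "wnorm P (x t) = 0"
      using t by (intro settled[OF sol \<mu>' w]) auto
  qed
qed

end

section \<open>The closed-loop system\<close>

lemma inner_transpose_vec:
  fixes A :: "real^'n^'m"
  shows "x \<bullet> (transpose A *v y) = (A *v x) \<bullet> y"
  by (metis dot_lmul_matrix inner_commute transpose_matrix_vector)

lemma pos_def_invertible: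
  fixes X :: "real^'n^'n" assumes "pos_def X" shows "invertible X"
proof -
  have "\<forall>x. X *v x = 0 \<longrightarrow> x = 0"
    using assms unfolding pos_def_def by (metis inner_zero_right less_irrefl)
  then show ?thesis using matrix_left_invertible_ker invertible_left_inverse by blast
qed

lemma pos_def_matrix_inv:
  fixes X :: "real^'n^'n" assumes X: "pos_def X"
  shows "pos_def (matrix_inv X)"
  unfolding pos_def_def
proof (intro conjI allI impI)
  let ?P = "matrix_inv X"
  note inv = matrix_inv_mult[OF pos_def_invertible[OF X]] matrix_inv_mult_vec[OF pos_def_invertible[OF X]]
  have tX: "transpose X = X" using X by (simp add: pos_def_def)
  have "transpose ?P = transpose ?P ** (X ** ?P)" by (simp add: inv)
  also have "\<dots> = transpose (X ** ?P) ** ?P" by (simp add: matrix_mul_assoc matrix_transpose_mul tX)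
  also have "\<dots> = ?P" by (simp add: inv)
  finally show "transpose ?P = ?P" .
  fix x :: "real^'n" assume "x \<noteq> 0"
  then have "?P *v x \<noteq> 0" using inv(3)[of x] by auto
  then have "0 < (?P *v x) \<bullet> (X *v (?P *v x))" using X by (simp add: pos_def_def)
  then show "0 < x \<bullet> (?P *v x)" by (simp add: inv inner_commute)
qed

text \<open>Symmetrization does not change a quadratic form, so the form of \<open>P ** G\<close> is
  positive. Comparing it with that of \<open>P\<close> in both directions yields \<open>a\<close>
  and \<open>b = 1 / c\<close>.\<close>

lemma monotone_dilation_exists:
  fixes \<Gamma> P G :: "real^'n^'n"
  assumes \<Gamma>: "invertible \<Gamma>" and P: "pos_def P" and G: "G = \<Gamma> ** diag_mat g ** matrix_inv \<Gamma>"
    and mono: "pos_def (P ** G + transpose G ** P)"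
  obtains a b where "monotone_dilation \<Gamma> P g a b"
proof -
  have Px: "\<And>x. x \<noteq> 0 \<Longrightarrow> 0 < x \<bullet> (P *v x)" and tP: "transpose P = P"
    using P by (auto simp: pos_def_def)
  have PGx: "0 < x \<bullet> ((P ** G) *v x)" if "x \<noteq> 0" for x
  proof -
    have "0 < x \<bullet> ((P ** G + transpose G ** P) *v x)" using mono that by (simp add: pos_def_def)
    also have "\<dots> = x \<bullet> (P *v (G *v x)) + x \<bullet> (transpose G *v (P *v x))"
      by (simp add: matrix_vector_mult_add_rdistrib inner_add_right matrix_vector_mul_assoc)
    also have "x \<bullet> (transpose G *v (P *v x)) = x \<bullet> (P *v (G *v x))"
      using inner_transpose_vec[of x P "G *v x"] unfolding inner_transpose_vec tP
      by (simp add: inner_commute)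
    finally show ?thesis by (simp add: matrix_vector_mul_assoc)
  qed
  obtain a where a: "0 < a" "\<And>x. a * (x \<bullet> (P *v x)) \<le> x \<bullet> ((P ** G) *v x)"
    using quadform_compare[OF Px PGx] by blast
  obtain c where c: "0 < c" "\<And>x. c * (x \<bullet> ((P ** G) *v x)) \<le> x \<bullet> (P *v x)"
    using quadform_compare[OF PGx Px] by blast
  have eq: "x \<bullet> ((P ** G) *v x) = x \<bullet> (P *v diag_apply \<Gamma> g x)" for x
    by (simp add: G diag_apply_matrix flip: matrix_vector_mul_assoc[of P])
  have "monotone_dilation \<Gamma> P g a (1 / c)"
  proof
    show "x \<bullet> (P *v diag_apply \<Gamma> g x) \<le> 1 / c * (x \<bullet> (P *v x))" for x
      using c(1) c(2)[of x] by (simp add: eq field_simps)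
  qed (use \<Gamma> tP Px a in \<open>auto simp: eq\<close>)
  then show ?thesis by (rule that)
qed

text \<open>For positive argument and quantized value \<open>v\<close>, the cell inequalities
  rearrange to \<open>(1 - \<delta>) * \<phi> \<le> v < (1 + \<delta>) * \<phi>\<close>; oddness
  does the rest.\<close>

lemma log_quant_near:
  assumes "0 < \<delta>" "\<delta> < 1" "0 < \<zeta>0"
  shows "\<bar>log_quant \<delta> \<zeta>0 \<phi> - \<phi>\<bar> \<le> \<delta> * \<bar>\<phi>\<bar>"
proof -
  have pos: "\<bar>quant_ratio \<delta> powi (THE i. quant_cell \<delta> \<zeta>0 p i) * \<zeta>0 - p\<bar> \<le> \<delta> * p" if p: "0 < p" for p
  proof -
    have "quant_cell \<delta> \<zeta>0 p (THE i. quant_cell \<delta> \<zeta>0 p i)"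
      by (rule theI'[OF ex1_quant_cell[OF assms p]])
    then show ?thesis
      using assms by (simp add: quant_cell_def field_simps abs_le_iff)
  qed
  show ?thesis
    using pos[of \<phi>] pos[of "-\<phi>"] by (cases \<phi> "0::real" rule: linorder_cases) (auto simp: log_quant_def)
qed

lemma vec_quant_diag:
  fixes \<Gamma> :: "real^'n^'n"
  assumes "0 < \<delta>" "\<delta> < 1" "0 < \<zeta>0"
  shows "\<exists>w. (\<forall>i. \<bar>w $ i - 1\<bar> \<le> \<delta>) \<and> vec_quant \<Gamma> \<delta> \<zeta>0 x = diag_apply \<Gamma> w x"
proof -
  define \<xi> where "\<xi> = matrix_inv \<Gamma> *v x"
  \<comment> \<open>At a zero coordinate the quantizer returns 0, so any factor fits; 1 respects the
    bound.\<close>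
  define w :: "real^'n" where
    "w = (\<chi> i. if \<xi> $ i = 0 then 1 else log_quant \<delta> \<zeta>0 (\<xi> $ i) / \<xi> $ i)"
  have "\<bar>w $ i - 1\<bar> \<le> \<delta>" for i
  proof (cases "\<xi> $ i = 0")
    case False
    then have "w $ i - 1 = (log_quant \<delta> \<zeta>0 (\<xi> $ i) - \<xi> $ i) / \<xi> $ i"
      by (simp add: w_def diff_divide_distrib)
    then show ?thesis
      using log_quant_near[OF assms, of "\<xi> $ i"] False by (simp add: abs_divide divide_le_eq)
  qed (use assms in \<open>simp add: w_def\<close>)
  moreover have "(\<chi> i. log_quant \<delta> \<zeta>0 (\<xi> $ i)) = w * \<xi>"
    by (simp add: vec_eq_iff w_def log_quant_def)
  ultimately show ?thesis
    by (intro exI[of _ w]) (simp add: vec_quant_def diag_apply_def \<xi>_def)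
qed

text \<open>In the eigenbasis \<open>comm\<close> forces \<open>L $ i $ j = 0\<close> unless
  \<open>lam $ j = lam $ i + 1\<close>. For such a pair the dilation weights satisfy
  \<open>e $ j = exp (\<mu> * s) * e $ i\<close>, so the identity holds entry by entry.\<close>

lemma commutator_dilation:
  fixes A0 :: "real^'n^'n"
  assumes \<Gamma>: "invertible \<Gamma>"
    and comm: "\<And>x. A0 *v diag_apply \<Gamma> lam x = diag_apply \<Gamma> lam (A0 *v x) + A0 *v x"
  shows "A0 *v diag_apply \<Gamma> (\<chi> i. exp (s * (1 + \<mu> * lam $ i))) x =
    exp (\<mu> * s) *\<^sub>R diag_apply \<Gamma> (\<chi> i. exp (s * (1 + \<mu> * lam $ i))) (A0 *v x)"
proof -
  define L where "L = matrix_inv \<Gamma> ** A0 ** \<Gamma>"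
  define e where "e = (\<chi> i. exp (s * (1 + \<mu> * lam $ i)))"
  have A0: "A0 *v (\<Gamma> *v y) = \<Gamma> *v (L *v y)" for y
    using \<Gamma> by (simp add: L_def matrix_inv_mult_vec flip: matrix_vector_mul_assoc)
  have "L *v (lam * y) = lam * (L *v y) + L *v y" for y
  proof -
    have "\<Gamma> *v (L *v (lam * y)) = \<Gamma> *v (lam * (L *v y) + L *v y)"
      using comm[of "\<Gamma> *v y"] \<Gamma>
      by (simp add: diag_apply_def matrix_inv_mult_vec A0 matrix_vector_right_distrib)
    then show ?thesis by (metis \<Gamma> matrix_inv_mult_vec(2))
  qed
  from this[of "axis _ 1"] have "L $ i $ j * lam $ j = lam $ i * L $ i $ j + L $ i $ j" for i j
  proof -
    assume *: "\<And>j. L *v (lam * axis j 1) = lam * (L *v axis j 1) + L *v axis j 1"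
    have "lam * axis j 1 = lam $ j *\<^sub>R axis j 1" by (simp add: vec_eq_iff axis_def)
    then have "lam $ j *\<^sub>R column j L = lam * column j L + column j L"
      using *[of j] by (simp add: matrix_vector_mult_scaleR matrix_vector_mult_basis)
    then show ?thesis by (simp add: vec_eq_iff column_def mult.commute)
  qed
  then have ent: "L $ i $ j = 0 \<or> lam $ j = lam $ i + 1" for i j
    by (metis add.commute distrib_right mult.commute mult_cancel_left mult_1)
  have *: "L $ i $ j * (e $ j * y $ j) = exp (\<mu> * s) * (e $ i * (L $ i $ j * y $ j))" for i j and y :: "real^'n"
    using ent[of i j] by (auto simp: e_def algebra_simps simp flip: exp_add)
  have "L *v (e * y) = exp (\<mu> * s) *\<^sub>R (e * (L *v y))" for y
    by (simp add: vec_eq_iff matrix_vector_mult_def sum_distrib_left) (intro allI sum.cong refl *)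
  moreover have "matrix_inv \<Gamma> *v (A0 *v x) = L *v (matrix_inv \<Gamma> *v x)"
    using \<Gamma> by (simp add: L_def matrix_inv_mult_vec flip: matrix_vector_mul_assoc)
  ultimately show ?thesis
    by (simp add: diag_apply_def A0 matrix_vector_mult_scaleR flip: e_def)
qed

text \<open>Each eigencoordinate of \<open>y\<close> either vanishes or has eigenvalue 0, in which
  case its weight is \<open>exp s\<close>.\<close>

lemma kernel_dilation:
  fixes \<Gamma> :: "real^'n^'n"
  assumes \<Gamma>: "invertible \<Gamma>" and ker: "diag_apply \<Gamma> lam y = 0"
  shows "diag_apply \<Gamma> (\<chi> i. exp (s * (1 + \<mu> * lam $ i))) y = exp s *\<^sub>R y"
proof -
  define \<xi> where "\<xi> = matrix_inv \<Gamma> *v y"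
  have "matrix_inv \<Gamma> *v (\<Gamma> *v (lam * \<xi>)) = 0" using ker by (simp add: diag_apply_def \<xi>_def)
  then have "lam * \<xi> = 0" using \<Gamma> by (simp add: matrix_inv_mult_vec)
  then have "\<And>i. lam $ i = 0 \<or> \<xi> $ i = 0" by (simp add: vec_eq_iff)
  then have "(\<chi> i. exp (s * (1 + \<mu> * lam $ i))) * \<xi> = exp s *\<^sub>R \<xi>"
    by (simp add: vec_eq_iff) (metis mult_zero_right add.right_neutral mult.right_neutral)
  then show ?thesis
    using \<Gamma> by (simp add: diag_apply_def matrix_vector_mult_scaleR matrix_inv_mult_vec flip: \<xi>_def) (simp add: \<xi>_def \<Gamma> matrix_inv_mult_vec)
qed

theorem corollary2:
  fixes A G0 A0 \<Gamma> G1 G2 X P :: "real^'n^'n"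
    and B :: "real^'m^'n"
    and Y0 K0 Y K :: "real^'n^'m"
    and lam :: "real^'n"
    and \<mu>1 \<mu>2 \<zeta>0 :: real
  assumes ctrb: "controllable A B"
    and G0_eq: "A ** G0 + B ** Y0 = G0 ** A + A"
    and G0_B: "G0 ** B = 0"
    and G0_inv: "invertible (G0 - mat 1)"
    and G0_hurw: "\<forall>\<mu>. -1 \<le> \<mu> \<and> \<mu> \<le> 1 / real CARD('n) \<longrightarrow> anti_hurwitz (mat 1 + \<mu> *\<^sub>R G0)"
    and K0: "K0 = Y0 ** matrix_inv (G0 - mat 1)"
    and A0: "A0 = A + B ** K0"
    and A0_nilpotent: "nilpotent A0"
    and \<Gamma>_inv: "invertible \<Gamma>"
    and G0_diag: "G0 = \<Gamma> ** diag_mat lam ** matrix_inv \<Gamma>"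
    and \<mu>1: "0 \<le> \<mu>1" "\<mu>1 \<le> 1 / real CARD('n)"
    and \<mu>2: "-1 \<le> \<mu>2" "\<mu>2 < 0"
    and G1: "G1 = mat 1 + \<mu>1 *\<^sub>R G0"
    and G2: "G2 = mat 1 + \<mu>2 *\<^sub>R G0"
    and lmi1: "neg_def (X ** transpose A0 + A0 ** X + transpose Y ** transpose B + B ** Y)"
    and lmi2: "pos_def X"
    and lmi3: "pos_semidef ((2 * (1 + \<mu>1)) *\<^sub>R X - (X ** transpose G1 + G1 ** X))"
    and lmi4: "pos_def (X ** transpose G1 + G1 ** X)"
    and lmi5: "pos_semidef (X ** transpose G2 + G2 ** X - (2 * (1 + \<mu>2)) *\<^sub>R X)"
    and K: "K = Y ** matrix_inv X"
    and P: "P = matrix_inv X"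
    and mono1: "pos_def (P ** G1 + transpose G1 ** P)"
    and mono2: "pos_def (P ** G2 + transpose G2 ** P)"
    and \<zeta>0: "0 < \<zeta>0"
  shows "\<exists>\<delta>0. 0 < \<delta>0 \<and> \<delta>0 < 1 \<and> (\<forall>\<delta>. 0 < \<delta> \<and> \<delta> < \<delta>0 \<longrightarrow>
           (let f = (\<lambda>x. A *v x + B *v switched_feedback K0 K P G1 \<mu>1 G2 \<mu>2 (vec_quant \<Gamma> \<delta> \<zeta>0 x))
            in (\<mu>1 = 0 \<longrightarrow> finite_time_stable (wnorm P) f) \<and>
               (\<mu>1 > 0 \<longrightarrow> fixed_time_stable (wnorm P) f)))"
proof -
  define g where "g = (\<lambda>\<mu>. \<chi> i. 1 + \<mu> * lam $ i)"
  have G0_vec: "G0 *v x = diag_apply \<Gamma> lam x" for x by (simp add: G0_diag diag_apply_matrix)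
  interpret diag: bounded_bilinear "diag_apply \<Gamma>" by (rule bounded_bilinear_diag_apply)
  have G_diag: "mat 1 + \<mu> *\<^sub>R G0 = \<Gamma> ** diag_mat (g \<mu>) ** matrix_inv \<Gamma>" for \<mu>
  proof -
    have "g \<mu> = 1 + \<mu> *\<^sub>R lam" by (simp add: g_def vec_eq_iff)
    then show ?thesis
      using \<Gamma>_inv by (simp add: matrix_eq diag_apply_matrix matrix_vector_mult_add_rdistrib
          diag.add_left diag.scaleR_left G0_vec flip: scaleR_matrix_vector_assoc)
  qed
  have X_inv: "X *v (P *v x) = x" for x
    unfolding P by (rule matrix_inv_mult_vec[OF pos_def_invertible[OF lmi2]])
  have tX: "transpose X = X" using lmi2 by (simp add: pos_def_def)
  have posP: "pos_def P" unfolding P by (rule pos_def_matrix_inv[OF lmi2])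
  have P_pos: "0 < x \<bullet> (P *v x)" if "x \<noteq> 0" for x using posP that by (simp add: pos_def_def)
  \<comment> \<open>The last matrix inequality is tested at \<open>P *v v\<close> with
    \<open>v\<close> an eigenvector of \<open>G0\<close>. It yields
    \<open>\<mu>2 * (lam $ i - 1) \<ge> 0\<close>, and \<open>\<mu>2\<close> is negative.\<close>
  have lam_le: "lam $ i \<le> 1" for i
  proof -
    define v where "v = \<Gamma> *v axis i 1"
    define y where "y = P *v v"
    have "matrix_inv \<Gamma> *v v = axis i 1" using \<Gamma>_inv by (simp add: v_def matrix_inv_mult_vec)
    moreover have "lam * axis i 1 = lam $ i *\<^sub>R axis i 1" by (simp add: vec_eq_iff axis_def)
    ultimately have "G0 *v v = lam $ i *\<^sub>R v"
      by (simp add: G0_vec diag_apply_def matrix_vector_mult_scaleR) (simp add: v_def)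
    then have G2v: "G2 *v v = (1 + \<mu>2 * lam $ i) *\<^sub>R v"
      by (simp add: G2 matrix_vector_mult_add_rdistrib scaleR_add_left flip: scaleR_matrix_vector_assoc)
    have "v \<noteq> 0"
      using \<open>matrix_inv \<Gamma> *v v = axis i 1\<close> by (auto simp: axis_eq_0_iff)
    then have pos: "0 < y \<bullet> v" using P_pos[of v] by (simp add: y_def inner_commute)
    have "y \<bullet> (X *v (transpose G2 *v y)) = (G2 *v v) \<bullet> y"
      using inner_transpose_vec[of y X "transpose G2 *v y"]
      unfolding tX inner_transpose_vec[of v G2] y_def X_inv .
    moreover have "0 \<le> y \<bullet> ((X ** transpose G2 + G2 ** X - (2 * (1 + \<mu>2)) *\<^sub>R X) *v y)"
      using lmi5 by (simp add: pos_semidef_def)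
    ultimately have "0 \<le> (G2 *v v) \<bullet> y + y \<bullet> (G2 *v v) - 2 * (1 + \<mu>2) * (y \<bullet> v)"
      by (simp add: matrix_vector_mult_diff_rdistrib matrix_vector_mult_add_rdistrib inner_add_right
          inner_diff_right y_def X_inv flip: matrix_vector_mul_assoc scaleR_matrix_vector_assoc)
    then have "0 \<le> \<mu>2 * (lam $ i - 1) * (y \<bullet> v)"
      by (simp add: G2v inner_commute algebra_simps)
    then have "0 \<le> \<mu>2 * (lam $ i - 1)" using pos by (simp add: zero_le_mult_iff)
    then show ?thesis using \<mu>2 by (simp add: zero_le_mult_iff)
  qed
  \<comment> \<open>The substitution \<open>x = X *v y\<close> turns \<open>lmi1\<close> into a
    statement on the closed-loop matrix, as \<open>K *v x = Y *v y\<close>.\<close>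
  have decr: "x \<bullet> (P *v ((A0 + B ** K) *v x)) < 0" if "x \<noteq> 0" for x
  proof -
    define y where "y = P *v x"
    have Xy: "X *v y = x" by (simp add: y_def X_inv)
    then have "y \<noteq> 0" using that by auto
    then have "0 > y \<bullet> ((X ** transpose A0 + A0 ** X + transpose Y ** transpose B + B ** Y) *v y)"
      using lmi1 by (simp add: neg_def_def)
    moreover have "y \<bullet> (X *v (transpose A0 *v y)) = (A0 *v x) \<bullet> y"
      using inner_transpose_vec[of y X "transpose A0 *v y"]
      unfolding tX Xy inner_transpose_vec[of x A0] .
    moreover have "y \<bullet> (transpose Y *v (transpose B *v y)) = y \<bullet> (B *v (Y *v y))"
      unfolding inner_transpose_vec[of y Y] inner_transpose_vec[of "Y *v y" B] by (rule inner_commute)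
    ultimately have "0 > 2 * (y \<bullet> (A0 *v x + B *v (Y *v y)))"
      by (simp add: matrix_vector_mult_add_rdistrib inner_add_right inner_transpose_vec Xy
          inner_commute flip: matrix_vector_mul_assoc)
    moreover have "(A0 + B ** K) *v x = A0 *v x + B *v (Y *v y)"
      by (simp add: K y_def P matrix_vector_mult_add_rdistrib flip: matrix_vector_mul_assoc)
    moreover have "x \<bullet> (P *v z) = y \<bullet> z" for z
      using posP inner_transpose_vec[of x P z] by (simp add: y_def pos_def_def)
    ultimately show ?thesis by simp
  qed
  have K0_eq: "K0 *v (G0 *v x) = Y0 *v x + K0 *v x" for x
  proof -
    have "K0 *v ((G0 - mat 1) *v x) = Y0 *v x"
      by (simp add: K0 matrix_inv_mult_vec[OF G0_inv] flip: matrix_vector_mul_assoc)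
    then show ?thesis
      by (simp add: matrix_vector_mult_diff_rdistrib matrix_vector_mult_diff_distrib algebra_simps)
  qed
  have G0B: "diag_apply \<Gamma> lam (B *v u) = 0" for u
    by (simp add: G0_vec[symmetric] matrix_vector_mul_assoc G0_B)
  have A0_vec: "A0 *v x = A *v x + B *v (K0 *v x)" for x
    by (simp add: A0 matrix_vector_mult_add_rdistrib flip: matrix_vector_mul_assoc)
  \<comment> \<open>\<open>K0_eq\<close> replaces \<open>B ** Y0\<close> in the equation for
    \<open>G0\<close> by \<open>B ** K0 ** G0 - B ** K0\<close>; with \<open>G0 ** B = 0\<close>
    this reads \<open>A0 ** G0 = G0 ** A0 + A0\<close>.\<close>
  have comm: "A0 *v diag_apply \<Gamma> lam x = diag_apply \<Gamma> lam (A0 *v x) + A0 *v x" for x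
  proof -
    have "A *v (G0 *v x) + B *v (Y0 *v x) = G0 *v (A *v x) + A *v x"
      using arg_cong[OF G0_eq, of "\<lambda>M. M *v x"]
      by (simp add: matrix_vector_mult_add_rdistrib flip: matrix_vector_mul_assoc)
    then show ?thesis
      by (simp add: A0_vec K0_eq G0B matrix_vector_right_distrib diag.add_right flip: G0_vec)
         (simp add: G0_vec G0B)
  qed
  obtain a1 b1 where m1: "monotone_dilation \<Gamma> P (g \<mu>1) a1 b1"
    using monotone_dilation_exists[OF \<Gamma>_inv posP _ mono1] G1 G_diag by blast
  obtain a2 b2 where m2: "monotone_dilation \<Gamma> P (g \<mu>2) a2 b2"
    using monotone_dilation_exists[OF \<Gamma>_inv posP _ mono2] G2 G_diag by blast
  have AD: "A0 *v monotone_dilation.D \<Gamma> (g \<mu>) s x = exp (\<mu> * s) *\<^sub>R monotone_dilation.D \<Gamma> (g \<mu>) s (A0 *v x)"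
    if "monotone_dilation \<Gamma> P (g \<mu>) a b" for \<mu> s x a b
    unfolding monotone_dilation.D_def[OF that] using commutator_dilation[OF \<Gamma>_inv comm] by (simp add: g_def)
  have BD: "monotone_dilation.D \<Gamma> (g \<mu>) s (B *v u) = exp s *\<^sub>R (B *v u)"
    if "monotone_dilation \<Gamma> P (g \<mu>) a b" for \<mu> s u a b
    unfolding monotone_dilation.D_def[OF that] using kernel_dilation[OF \<Gamma>_inv G0B] by (simp add: g_def)
  note G1' = G1[unfolded G_diag] and G2' = G2[unfolded G_diag]
  \<comment> \<open>The squared norm depends on \<open>P\<close> alone, so the two stages share it
    and meet at the same unit sphere.\<close>
  let ?V = "monotone_dilation.V P"
  obtain \<eta>1 \<kappa>1 \<rho>1 \<delta>1 where \<delta>1: "0 < \<delta>1" and stage1: "\<And>f w h. (\<forall>x i. \<bar>w x $ i - 1\<bar> \<le> \<delta>1) \<and>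
     (\<forall>x. f x = A0 *v x + B *v (K0 *v (diag_apply \<Gamma> (w x) x - x) + h x)) \<and>
     (\<forall>x. h x = hom_term K P G1 \<mu>1 (diag_apply \<Gamma> (w x) x) \<or>
        ?V (diag_apply \<Gamma> (w x) x) < 1 \<and> h x = hom_term K P G2 \<mu>2 (diag_apply \<Gamma> (w x) x))
     \<Longrightarrow> homogeneous_stage \<Gamma> P (g \<mu>1) a1 b1 f (A0 + B ** K) \<mu>1 \<eta>1 \<kappa>1 \<rho>1 {0..}"
    using monotone_dilation.homogeneous_stage_exists[OF m1 m2 g_def[THEN fun_cong] lam_le AD[OF m1] BD[OF m1] decr,
        of "{0..}" "\<lambda>v. v < 1" K0 \<mu>2] \<mu>1(1)
    unfolding G1' G2' by blast
  obtain \<eta>2 \<kappa>2 \<rho>2 \<delta>2 where \<delta>2: "0 < \<delta>2" and stage2: "\<And>f w h. (\<forall>x i. \<bar>w x $ i - 1\<bar> \<le> \<delta>2) \<and>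
     (\<forall>x. f x = A0 *v x + B *v (K0 *v (diag_apply \<Gamma> (w x) x - x) + h x)) \<and>
     (\<forall>x. h x = hom_term K P G2 \<mu>2 (diag_apply \<Gamma> (w x) x) \<or>
        1 \<le> ?V (diag_apply \<Gamma> (w x) x) \<and> h x = hom_term K P G1 \<mu>1 (diag_apply \<Gamma> (w x) x))
     \<Longrightarrow> homogeneous_stage \<Gamma> P (g \<mu>2) a2 b2 f (A0 + B ** K) \<mu>2 \<eta>2 \<kappa>2 \<rho>2 {..0}"
    using monotone_dilation.homogeneous_stage_exists[OF m2 m1 g_def[THEN fun_cong] lam_le AD[OF m2] BD[OF m2] decr,
        of "{..0}" "\<lambda>v. 1 \<le> v" K0 \<mu>1] less_imp_le[OF \<mu>2(2)]
    unfolding G1' G2' by blast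
  define \<delta>0 where "\<delta>0 = min (1 / 2) (min \<delta>1 \<delta>2)"
  show ?thesis
  proof (intro exI conjI allI impI)
    show "0 < \<delta>0" "\<delta>0 < 1" using \<delta>1 \<delta>2 by (auto simp: \<delta>0_def)
    fix \<delta> assume \<delta>: "0 < \<delta> \<and> \<delta> < \<delta>0"
    define f where "f = (\<lambda>x. A *v x + B *v switched_feedback K0 K P G1 \<mu>1 G2 \<mu>2 (vec_quant \<Gamma> \<delta> \<zeta>0 x))"
    have "\<exists>w. \<forall>x. (\<forall>i. \<bar>w x $ i - 1\<bar> \<le> \<delta>) \<and> vec_quant \<Gamma> \<delta> \<zeta>0 x = diag_apply \<Gamma> (w x) x"
      using vec_quant_diag[of \<delta> \<zeta>0 \<Gamma>] \<delta> \<zeta>0 \<open>\<delta>0 < 1\<close> by (intro choice) auto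
    then obtain w where w: "\<And>x i. \<bar>w x $ i - 1\<bar> \<le> \<delta>"
      and q: "\<And>x. vec_quant \<Gamma> \<delta> \<zeta>0 x = diag_apply \<Gamma> (w x) x" by blast
    \<comment> \<open>One \<open>h\<close> fits both stages: the branch native to one of them is the
      foreign branch of the other, with complementary conditions.\<close>
    define h where "h = (\<lambda>x. if 1 \<le> ?V (diag_apply \<Gamma> (w x) x)
      then hom_term K P G1 \<mu>1 (diag_apply \<Gamma> (w x) x) else hom_term K P G2 \<mu>2 (diag_apply \<Gamma> (w x) x))"
    have f: "f x = A0 *v x + B *v (K0 *v (diag_apply \<Gamma> (w x) x - x) + h x)" for x
      by (simp add: f_def q switched_feedback_def monotone_dilation.wnorm_V[OF m1] h_def A0_vec
          matrix_vector_right_distrib matrix_vector_mult_diff_distrib)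
    have "homogeneous_stage \<Gamma> P (g \<mu>1) a1 b1 f (A0 + B ** K) \<mu>1 \<eta>1 \<kappa>1 \<rho>1 {0..}"
    proof (rule stage1[of w f h], intro conjI allI f)
      show "\<bar>w x $ i - 1\<bar> \<le> \<delta>1" for x i using w[of x i] \<delta> by (simp add: \<delta>0_def)
    qed (auto simp: h_def)
    moreover have "homogeneous_stage \<Gamma> P (g \<mu>2) a2 b2 f (A0 + B ** K) \<mu>2 \<eta>2 \<kappa>2 \<rho>2 {..0}"
    proof (rule stage2[of w f h], intro conjI allI f)
      show "\<bar>w x $ i - 1\<bar> \<le> \<delta>2" for x i using w[of x i] \<delta> by (simp add: \<delta>0_def)
    qed (auto simp: h_def)
    ultimately interpret two_stages \<Gamma> P "g \<mu>1" a1 b1 f "A0 + B ** K" \<mu>1 \<eta>1 \<kappa>1 \<rho>1 "g \<mu>2" a2 b2 \<mu>2 \<eta>2 \<kappa>2 \<rho>2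
      by (rule two_stages.intro)
    have "finite_time_stable (wnorm P) f" if "\<mu>1 = 0"
      unfolding finite_time_stable_def using lyapunov settling_time_finite[OF that \<mu>2(2)] by blast
    moreover have "fixed_time_stable (wnorm P) f" if "0 < \<mu>1"
      unfolding fixed_time_stable_def finite_time_stable_def
      using lyapunov settling_time_fixed[OF that \<mu>2(2)] by blast
    ultimately show "let f = (\<lambda>x. A *v x + B *v switched_feedback K0 K P G1 \<mu>1 G2 \<mu>2 (vec_quant \<Gamma> \<delta> \<zeta>0 x))
            in (\<mu>1 = 0 \<longrightarrow> finite_time_stable (wnorm P) f) \<and> (\<mu>1 > 0 \<longrightarrow> fixed_time_stable (wnorm P) f)"
      unfolding f_def[symmetric] Let_def by blast
  qed
qed

end
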